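(* (a) (ZFC) Every Menger space that is a perfect preimage of an analytic set is $\sigma$-compact. (b) Assuming $\sigma$-projective determinacy, every Menger space that is a perfect preimage of a $\sigma$-projective set is $\sigma$-compact.
   Context: Spaces are completely regular. A perfect map is a continuous closed surjection with compact fibers; $X$ is a perfect preimage of $B$ if there is a perfect map from $X$ onto $B$. Analytic sets are continuous images of the irrationals; $\sigma$-projective sets are the sets of reals in $\mathbf{\Sigma}^1_{\omega_1}$ of the transfinite projective hierarchy. $\sigma$-projective determinacy: all length-$\omega$ perfect-information games on $\omega$ with $\sigma$-projective payoff are determined. Menger: for every sequence $(\mathcal{U}_n)$ of open covers there are finite $\mathcal{V}_n\subseteq\mathcal{U}_n$ whose union is a cover. *)

theory Defs
  imports "HOL-Analysis.Analysis"
begin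

definition menger_space :: "'a topology \<Rightarrow> bool" where
  "menger_space X \<longleftrightarrow>
     (\<forall>U :: nat \<Rightarrow> 'a set set.
        (\<forall>n. (\<forall>u\<in>U n. openin X u) \<and> \<Union>(U n) = topspace X) \<longrightarrow>
        (\<exists>V. (\<forall>n. finite (V n) \<and> V n \<subseteq> U n) \<and> (\<Union>n. \<Union>(V n)) = topspace X))"

definition sigma_compact_space :: "'a topology \<Rightarrow> bool" where
  "sigma_compact_space X \<longleftrightarrow>
     (\<exists>K :: nat \<Rightarrow> 'a set. (\<forall>n. compactin X (K n)) \<and> (\<Union>n. K n) = topspace X)"

definition perfect_preimage :: "'a topology \<Rightarrow> 'b topology \<Rightarrow> bool" where
  "perfect_preimage X B \<longleftrightarrow> (\<exists>p. perfect_map X B p)"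

text \<open>The empty space counts as analytic, although it is not an image of the irrationals.\<close>

definition analytic_space :: "'a topology \<Rightarrow> bool" where
  "analytic_space B \<longleftrightarrow>
     topspace B = {} \<or>
     (\<exists>f. continuous_map (top_of_set (- \<rat> :: real set)) B f \<and> f ` (- \<rat>) = topspace B)"

text \<open>A well-order of type \<open>\<omega>\<^sub>1\<close>; the elements of its field serve as the countable ordinals.\<close>

definition omega1 :: "nat set rel" where
  "omega1 = cardSuc natLeq"

text \<open>
  The boldface classes \<open>\<Sigma>\<^sup>1\<close> of the transfinite projective hierarchy, for subsets of
  an uncountable Polish space (used below for the reals and for the Baire space). The least
  level consists of the analytic sets; at a successor one takes the continuous images of the
  complements of sets of the previous level; at a limit, the countable unions of sets of lower
  levels. The least ordinal indexes \<open>\<Sigma>\<^sup>1\<^sub>1\<close>, so finite indices are shifted by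
  one, and indices from \<open>\<omega>\<close> on are the usual ones. An index \<open>\<alpha>\<close> is the successor
  of \<open>\<beta>\<close> iff the ordinals below \<open>\<alpha>\<close> are exactly those up to \<open>\<beta>\<close>.
\<close>

definition Sigma1_step ::
    "(nat set \<Rightarrow> 'a::topological_space set set) \<Rightarrow> nat set \<Rightarrow> 'a set set" where
  "Sigma1_step S \<alpha> =
     (if underS omega1 \<alpha> = {} then {A. analytic_space (top_of_set A)}
      else if \<exists>\<beta>\<in>underS omega1 \<alpha>. underS omega1 \<alpha> = under omega1 \<beta>
      then {f ` A |f A. continuous_on A f \<and>
              (\<exists>\<beta>\<in>underS omega1 \<alpha>. underS omega1 \<alpha> = under omega1 \<beta> \<and> - A \<in> S \<beta>)}
      else {\<Union>n::nat. A n |A. \<forall>n. \<exists>\<beta>\<in>underS omega1 \<alpha>. A n \<in> S \<beta>})"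

definition Sigma1 :: "nat set \<Rightarrow> 'a::topological_space set set" where
  "Sigma1 = wo_rel.worec omega1 Sigma1_step"

lemma Sigma1_rec: "Sigma1 \<alpha> = Sigma1_step Sigma1 \<alpha>"
proof -
  have wo: "wo_rel omega1"
    using cardSuc_Card_order[OF natLeq_Card_order]
    by (simp add: omega1_def wo_rel_def card_order_on_def)
  have "wo_rel.adm_wo omega1 (Sigma1_step :: _ \<Rightarrow> _ \<Rightarrow> 'a set set)"
    unfolding wo_rel.adm_wo_def[OF wo]
  proof (intro allI impI)
    fix S T :: "nat set \<Rightarrow> 'a set set" and \<alpha>
    assume "\<forall>\<beta>\<in>underS omega1 \<alpha>. S \<beta> = T \<beta>"
    then have "(\<exists>\<beta>\<in>underS omega1 \<alpha>. P \<beta> \<and> A \<in> S \<beta>) \<longleftrightarrow>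
               (\<exists>\<beta>\<in>underS omega1 \<alpha>. P \<beta> \<and> A \<in> T \<beta>)" for P A
      by blast
    note this this[of "\<lambda>_. True", simplified]
    then show "Sigma1_step S \<alpha> = Sigma1_step T \<alpha>"
      unfolding Sigma1_step_def by presburger
  qed
  then show ?thesis
    unfolding Sigma1_def using wo_rel.worec_fixpoint[OF wo] by metis
qed

text \<open>
  The class \<open>\<Sigma>\<^sup>1\<close> at \<open>\<omega>\<^sub>1\<close>, that is, the limit clause of the hierarchy applied
  to all countable ordinals.
\<close>

definition sigma_projective :: "'a::topological_space set \<Rightarrow> bool" where
  "sigma_projective B \<longleftrightarrow>
     (\<exists>A :: nat \<Rightarrow> 'a set. (\<forall>n. \<exists>\<alpha>\<in>Field omega1. A n \<in> Sigma1 \<alpha>) \<and> B = (\<Union>n. A n))"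

text \<open>
  Games on \<open>\<omega>\<close> of length \<open>\<omega>\<close>: player I chooses the terms of \<open>x\<close> with even index and wins
  iff \<open>x\<close> is in the payoff set. A strategy maps the finite sequence of all previous moves to
  the next move.
\<close>

definition wins_I :: "(nat \<Rightarrow> nat) set \<Rightarrow> (nat list \<Rightarrow> nat) \<Rightarrow> bool" where
  "wins_I A s \<longleftrightarrow> (\<forall>x. (\<forall>n. even n \<longrightarrow> x n = s (map x [0..<n])) \<longrightarrow> x \<in> A)"

definition wins_II :: "(nat \<Rightarrow> nat) set \<Rightarrow> (nat list \<Rightarrow> nat) \<Rightarrow> bool" where
  "wins_II A s \<longleftrightarrow> (\<forall>x. (\<forall>n. odd n \<longrightarrow> x n = s (map x [0..<n])) \<longrightarrow> x \<notin> A)"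

definition determined :: "(nat \<Rightarrow> nat) set \<Rightarrow> bool" where
  "determined A \<longleftrightarrow> (\<exists>s. wins_I A s) \<or> (\<exists>s. wins_II A s)"

definition sigma_projective_determinacy :: bool where
  "sigma_projective_determinacy \<longleftrightarrow>
     (\<forall>A :: (nat \<Rightarrow> nat) set. sigma_projective A \<longrightarrow> determined A)"

end

theory Submission
  imports Defs
begin

text \<open>
  Perfect maps reduce both parts to showing that a Menger base space \<open>B\<close> is \<open>\<sigma>\<close>-compact.

  (a) Let \<open>B\<close> be a continuous image of the irrationals that is not \<open>\<sigma>\<close>-compact. Remove the part of the
  irrationals on which the map is locally \<open>\<sigma>\<close>-bounded. Every nonempty open part of the rest has
  an image with noncompact closure, which yields an increasing open cover none of whose closures
  contains that image. Shrinking open sets, player ONE thus avoids every answer of TWO and wins the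
  Menger game, which contradicts Hurewicz's theorem that ONE has no winning strategy in a Menger
  space.

  (b) The \<open>\<sigma>\<close>-projective sets form a \<open>\<sigma>\<close>-algebra closed under continuous images and preimages, so
  the Wadge game between the eventually zero sequences and \<open>B\<close> is determined. If the player who
  produces the sequence wins, then \<open>B\<close> is a countable union of compact sets. If the player who
  produces the real wins, there is a continuous \<open>g\<close> with \<open>g x \<in> B\<close> iff \<open>x\<close> is not eventually zero.
  The images under \<open>g\<close> of the 0-1 sequences with at most \<open>n\<close> ones before \<open>k\<close> are compact; for fixed
  \<open>n\<close>, their complements are an increasing open cover of \<open>B\<close>, and these covers contradict the
  Menger property, because a choice \<open>k = \<phi> n\<close> is defeated by a sufficiently sparse sequence.
\<close>

section \<open>The Menger game\<close>

lemma menger_space_obtain: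
  assumes "menger_space X" "\<And>n u. u \<in> U n \<Longrightarrow> openin X u" "\<And>n. \<Union>(U n) = topspace X"
  obtains V where "\<forall>n::nat. finite (V n)" "\<forall>n. V n \<subseteq> U n" "(\<Union>n. \<Union>(V n)) = topspace X"
proof -
  have "(\<forall>n. (\<forall>u\<in>U n. openin X u) \<and> \<Union>(U n) = topspace X)"
    using assms(2,3) by simp
  with assms(1)[unfolded menger_space_def, THEN spec, of U]
  have "\<exists>V. (\<forall>n. finite (V n) \<and> V n \<subseteq> U n) \<and> (\<Union>n. \<Union>(V n)) = topspace X"
    by (rule mp)
  then show thesis
    by (elim exE conjE) (rule that; simp)
qed

lemma menger_space_continuous_map_image:
  assumes "menger_space X" "continuous_map X Y p" "p ` topspace X = topspace Y"
  shows "menger_space Y"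
  unfolding menger_space_def
proof (intro allI impI)
  fix U :: "nat \<Rightarrow> 'b set set"
  assume U: "\<forall>n. (\<forall>u\<in>U n. openin Y u) \<and> \<Union>(U n) = topspace Y"
  define pre where "pre u = {x \<in> topspace X. p x \<in> u}" for u
  have "openin X v" if "v \<in> pre ` U n" for n v
    using that U assms(2) unfolding pre_def continuous_map_def by auto
  moreover have "\<Union>(pre ` U n) = topspace X" for n
  proof -
    have "p x \<in> \<Union>(U n)" if "x \<in> topspace X" for x
      using U assms(3) that by auto
    then show ?thesis
      unfolding pre_def by auto
  qed
  ultimately obtain V where V: "\<forall>n. finite (V n)" "\<forall>n. V n \<subseteq> pre ` U n"
      "(\<Union>n. \<Union>(V n)) = topspace X"
    by (rule menger_space_obtain[OF assms(1), where U = "\<lambda>n. pre ` U n"])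
  have "\<exists>W. W \<subseteq> U n \<and> finite W \<and> V n = pre ` W" for n
    using finite_subset_image[OF V(1)[rule_format] V(2)[rule_format], of n] .
  then obtain W where W: "\<And>n. W n \<subseteq> U n" "\<And>n. finite (W n)" "\<And>n. V n = pre ` W n"
    by metis
  have "(\<Union>n. \<Union>(W n)) = topspace Y"
  proof
    show "(\<Union>n. \<Union>(W n)) \<subseteq> topspace Y"
      using U W(1) by blast
    show "topspace Y \<subseteq> (\<Union>n. \<Union>(W n))"
    proof
      fix y assume "y \<in> topspace Y"
      then obtain x where x: "x \<in> topspace X" "y = p x" using assms(3) by auto
      then obtain n v where "v \<in> V n" "x \<in> v" using V(3) by blast
      then show "y \<in> (\<Union>n. \<Union>(W n))"
        using x W(3) unfolding pre_def by auto
    qed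
  qed
  then show "\<exists>V. (\<forall>n. finite (V n) \<and> V n \<subseteq> U n) \<and> (\<Union>n. \<Union>(V n)) = topspace Y"
    using W(1,2) by (intro exI[of _ W]) simp
qed

text \<open>Apply the Menger property to a constant sequence of covers and collect the countably
  many chosen sets.\<close>

lemma menger_space_imp_Lindelof_space:
  assumes "menger_space X"
  shows "Lindelof_space X"
  unfolding Lindelof_space_def
proof (intro allI impI)
  fix \<U> assume \<U>: "(\<forall>U\<in>\<U>. openin X U) \<and> \<Union>\<U> = topspace X"
  obtain V where V: "\<forall>n::nat. finite (V n)" "\<forall>n. V n \<subseteq> \<U>" "(\<Union>n. \<Union>(V n)) = topspace X"
    by (rule menger_space_obtain[OF assms, where U = "\<lambda>_. \<U>"]) (use \<U> in auto)
  have "countable (\<Union>n. V n)" "(\<Union>n. V n) \<subseteq> \<U>"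
    using V(1,2) by (auto intro: countable_finite)
  moreover have "\<Union>(\<Union>n. V n) = topspace X"
    unfolding V(3)[symmetric] by blast
  ultimately show "\<exists>\<V>. countable \<V> \<and> \<V> \<subseteq> \<U> \<and> \<Union>\<V> = topspace X"
    by (intro exI[of _ "\<Union>n. V n"] conjI)
qed

lemma sigma_compact_space_perfect_preimage:
  assumes "perfect_map X B p" "sigma_compact_space B"
  shows "sigma_compact_space X"
proof -
  obtain K where K: "\<And>n::nat. compactin B (K n)" "(\<Union>n. K n) = topspace B"
    using assms(2) unfolding sigma_compact_space_def by blast
  have "compactin X {x \<in> topspace X. p x \<in> K n}" for n
    using assms(1) K(1) compactin_proper_map_preimage unfolding perfect_map_def by metis
  moreover have "(\<Union>n. {x \<in> topspace X. p x \<in> K n}) = topspace X"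
    using K(2) assms(1) unfolding perfect_map_def by blast
  ultimately show ?thesis
    unfolding sigma_compact_space_def by (intro exI[of _ "\<lambda>n. {x \<in> topspace X. p x \<in> K n}"]) simp
qed

text \<open>
  Hurewicz: player ONE has no winning strategy in the Menger game. Here \<open>G h\<close> is the increasing
  cover played after the history \<open>h\<close> (most recent answer first), and it contains what has been
  covered before. Because of this, near a given point all but finitely many histories of a given
  length are irrelevant, so the intersections over all such histories are still open.
\<close>

lemma menger_space_defeats_strategy:
  fixes G :: "nat list \<Rightarrow> nat \<Rightarrow> 'a set"
  assumes "menger_space X"
    and G_open: "\<And>h n. openin X (G h n)"
    and cover: "\<And>h. (\<Union>n. G h n) = topspace X"
    and mono: "\<And>h m n. m \<le> n \<Longrightarrow> G h m \<subseteq> G h n"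
    and prev: "\<And>h m n. G h m \<subseteq> G (m # h) n"
  shows "\<exists>\<phi>::nat \<Rightarrow> nat. \<forall>x\<in>topspace X. \<exists>k. x \<in> G (rev (map \<phi> [0..<k])) (\<phi> k)"
proof -
  \<comment> \<open>Intersecting over all histories of length \<open>k\<close> removes the
    dependence on TWO's earlier answers, so the Menger property can be applied to the sequence of
    covers \<open>range (W k)\<close>.\<close>
  define W where "W k n = (\<Inter>h\<in>{h. length h = k}. G h n)" for k n
  have nhd: "\<exists>N. openin X N \<and> x \<in> N \<and> finite {h. length h = k \<and> (\<exists>n. \<not> N \<subseteq> G h n)}"
    if x: "x \<in> topspace X" for x k
  proof (induction k)
    case 0
    then show ?case
      using x by (intro exI[of _ "topspace X"]) (auto intro: finite_subset[of _ "{[]}"])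
  next
    case (Suc k)
    then obtain N where N: "openin X N" "x \<in> N"
      and fin: "finite {h. length h = k \<and> (\<exists>n. \<not> N \<subseteq> G h n)}" (is "finite ?F")
      by blast
    have "\<forall>h. \<exists>n. x \<in> G h n" using cover x by blast
    then obtain c where c: "\<And>h. x \<in> G h (c h)" by metis
    define N' where "N' = \<Inter>(insert N ((\<lambda>h. G h (c h)) ` ?F))"
    have "openin X N'"
      unfolding N'_def using N fin G_open by (intro openin_Inter) auto
    moreover have "x \<in> N'" unfolding N'_def using N c by auto
    moreover have "{h. length h = Suc k \<and> (\<exists>n. \<not> N' \<subseteq> G h n)} \<subseteq>
        (\<Union>h\<in>?F. (\<lambda>m. m # h) ` {..<c h})"
    proof
      \<comment> \<open>A bad history \<open>m # h'\<close> violates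
        \<open>N' \<subseteq> G h' m\<close> by \<open>prev\<close>. Hence \<open>h'\<close> is one
        of the finitely many bad histories of length \<open>k\<close>, and \<open>m < c h'\<close>
        because \<open>N'\<close> was shrunk into \<open>G h' (c h')\<close>. So each bad
        \<open>h'\<close> has only finitely many bad extensions.\<close>
      fix h assume h: "h \<in> {h. length h = Suc k \<and> (\<exists>n. \<not> N' \<subseteq> G h n)}"
      then obtain m h' n where eq: "h = m # h'" "length h' = k" and n: "\<not> N' \<subseteq> G (m # h') n"
        by (auto simp: length_Suc_conv)
      have *: "\<not> N' \<subseteq> G h' m" using n prev[of h' m n] by blast
      have "N' \<subseteq> N" unfolding N'_def by simp
      then have F: "h' \<in> ?F" using * eq by auto
      then have "N' \<subseteq> G h' (c h')" unfolding N'_def by (intro Inf_lower insertI2 imageI)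
      then have "m < c h'" using * mono[of "c h'" m h'] by (meson not_le_imp_less order_trans)
      then show "h \<in> (\<Union>h\<in>?F. (\<lambda>m. m # h) ` {..<c h})" using F eq(1) by (intro UN_I[OF F]) simp
    qed
    moreover have "finite (\<Union>h\<in>?F. (\<lambda>m. m # h) ` {..<c h})"
      using fin by blast
    ultimately have "openin X N'" "x \<in> N'"
      "finite {h. length h = Suc k \<and> (\<exists>n. \<not> N' \<subseteq> G h n)}"
      by (simp_all only: finite_subset)
    then show ?case by (intro exI[of _ N'] conjI)
  qed
  have W_open: "openin X (W k n)" for k n
  proof (subst openin_subopen, intro ballI)
    fix x assume x: "x \<in> W k n"
    have "W k n \<subseteq> G (replicate k 0) n" unfolding W_def by auto
    then have "x \<in> topspace X" using x G_open openin_subset by blast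
    then obtain N where N: "openin X N" "x \<in> N"
      and fin: "finite {h. length h = k \<and> (\<exists>n. \<not> N \<subseteq> G h n)}" (is "finite ?F")
      using nhd by blast
    define N' where "N' = \<Inter>(insert N ((\<lambda>h. G h n) ` ?F))"
    have "openin X N'" unfolding N'_def using N fin G_open by (intro openin_Inter) auto
    moreover have "x \<in> N'" unfolding N'_def using x N by (auto simp: W_def)
    moreover have "N' \<subseteq> W k n"
      unfolding N'_def W_def by auto
    ultimately show "\<exists>T. openin X T \<and> x \<in> T \<and> T \<subseteq> W k n" by blast
  qed
  have W_mono: "W k m \<subseteq> W k n" if "m \<le> n" for k m n
    using mono[OF that] unfolding W_def by blast
  have W_cover: "(\<Union>n. W k n) = topspace X" for k
  proof
    show "(\<Union>n. W k n) \<subseteq> topspace X" using W_open openin_subset by blast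
    show "topspace X \<subseteq> (\<Union>n. W k n)"
    proof
      fix x assume x: "x \<in> topspace X"
      then obtain N where N: "openin X N" "x \<in> N"
        and fin: "finite {h. length h = k \<and> (\<exists>n. \<not> N \<subseteq> G h n)}" (is "finite ?F")
        using nhd by blast
      have "\<forall>h. \<exists>n. x \<in> G h n" using cover x by blast
      then obtain c where c: "\<And>h. x \<in> G h (c h)" by metis
      \<comment> \<open>The bound is needed only for the finitely many bad histories; for every
        other \<open>h\<close>, the neighbourhood \<open>N\<close> of \<open>x\<close> lies in
        \<open>G h n\<close> for all \<open>n\<close>.\<close>
      obtain b where b: "\<And>h. h \<in> ?F \<Longrightarrow> c h \<le> b"
        using fin finite_nat_set_iff_bounded_le[of "c ` ?F"] by auto
      have "x \<in> G h b" if "length h = k" for h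
        using that b[of h] c[of h] mono[of "c h" b h] N(2) by blast
      then show "x \<in> (\<Union>n. W k n)" unfolding W_def by blast
    qed
  qed
  obtain V where V: "\<forall>k. finite (V k)" "\<forall>k. V k \<subseteq> range (W k)" "(\<Union>k. \<Union>(V k)) = topspace X"
    by (rule menger_space_obtain[OF assms(1), where U = "\<lambda>k. range (W k)"])
      (use W_open W_cover in auto)
  have "\<exists>b. \<Union>(V k) \<subseteq> W k b" for k
  proof -
    obtain I where I: "finite I" "V k = W k ` I"
      using finite_subset_image[OF V(1)[rule_format] V(2)[rule_format]] by metis
    obtain b where "\<And>n. n \<in> I \<Longrightarrow> n \<le> b"
      using I(1) unfolding finite_nat_set_iff_bounded_le by auto
    then have "\<Union>(V k) \<subseteq> W k b" unfolding I(2) by (intro Sup_least) (auto dest!: W_mono)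
    then show ?thesis ..
  qed
  then obtain \<phi> where \<phi>: "\<And>k. \<Union>(V k) \<subseteq> W k (\<phi> k)"
    using choice[of "\<lambda>k b. \<Union>(V k) \<subseteq> W k b"] by auto
  have "\<exists>k. x \<in> G (rev (map \<phi> [0..<k])) (\<phi> k)" if "x \<in> topspace X" for x
  proof -
    have "x \<in> (\<Union>k. \<Union>(V k))" using that V(3) by simp
    then obtain k where "x \<in> \<Union>(V k)" by (rule UN_E)
    then have "x \<in> W k (\<phi> k)" by (rule subsetD[OF \<phi>])
    then have "x \<in> G (rev (map \<phi> [0..<k])) (\<phi> k)" unfolding W_def by auto
    then show ?thesis ..
  qed
  then show ?thesis by blast
qed

section \<open>The sigma-ideal of sigma-bounded sets, and part (a)\<close>

definition sigma_bounded_in :: "'a topology \<Rightarrow> 'a set \<Rightarrow> bool" where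
  "sigma_bounded_in X A \<longleftrightarrow> (\<exists>K :: nat \<Rightarrow> 'a set. (\<forall>n. compactin X (K n)) \<and> A \<subseteq> (\<Union>n. K n))"

lemma sigma_bounded_in_subset:
  "sigma_bounded_in X A \<Longrightarrow> A' \<subseteq> A \<Longrightarrow> sigma_bounded_in X A'"
  unfolding sigma_bounded_in_def by blast

lemma sigma_bounded_in_countable_Union:
  fixes X :: "'a topology"
  assumes "countable I" "\<And>i. i \<in> I \<Longrightarrow> sigma_bounded_in X (A i)"
  shows "sigma_bounded_in X (\<Union>i\<in>I. A i)"
proof (cases "I = {}")
  case True
  then show ?thesis unfolding sigma_bounded_in_def by (auto intro!: exI[of _ "\<lambda>_. {}"])
next
  case False
  have "\<forall>i\<in>I. \<exists>K :: nat \<Rightarrow> 'a set. (\<forall>n. compactin X (K n)) \<and> A i \<subseteq> (\<Union>n. K n)"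
    using assms(2) unfolding sigma_bounded_in_def by blast
  then obtain K :: "_ \<Rightarrow> nat \<Rightarrow> 'a set" where
    K: "\<And>i n. i \<in> I \<Longrightarrow> compactin X (K i n)" "\<And>i. i \<in> I \<Longrightarrow> A i \<subseteq> (\<Union>n. K i n)"
    by metis
  define L where "L m = (case prod_decode m of (j, n) \<Rightarrow> K (from_nat_into I j) n)" for m
  have "compactin X (L m)" for m
    unfolding L_def using K(1) from_nat_into[OF False] by (auto split: prod.split)
  moreover have "(\<Union>i\<in>I. A i) \<subseteq> (\<Union>m. L m)"
  proof
    fix x assume "x \<in> (\<Union>i\<in>I. A i)"
    then obtain i n where i: "i \<in> I" "x \<in> K i n" using K(2) by blast
    obtain j where "from_nat_into I j = i" using i(1) assms(1) from_nat_into_surj by metis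
    then have "x \<in> L (prod_encode (j, n))" unfolding L_def using i(2) by simp
    then show "x \<in> (\<Union>m. L m)" by blast
  qed
  ultimately show ?thesis unfolding sigma_bounded_in_def by blast
qed

lemma sigma_compact_space_iff_sigma_bounded_in:
  fixes X :: "'a topology"
  shows
  "sigma_compact_space X \<longleftrightarrow> sigma_bounded_in X (topspace X)"
proof -
  have "((\<forall>n. compactin X (K n)) \<and> (\<Union>n. K n) = topspace X) \<longleftrightarrow>
      ((\<forall>n. compactin X (K n)) \<and> topspace X \<subseteq> (\<Union>n. K n))" for K :: "nat \<Rightarrow> 'a set"
    using compactin_subset_topspace[of X] by blast
  then show ?thesis
    unfolding sigma_compact_space_def sigma_bounded_in_def by simp
qed

text \<open>The closure of \<open>A\<close> is not compact, since otherwise it alone would witness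
  sigma-boundedness. Take an open cover of it without finite subcover and add the complement of the
  closure. Regularity refines this to open sets whose closures lie in members of the cover, the
  Lindelof property makes the refinement countable, and the \<open>G n\<close> are its finite
  partial unions.\<close>

lemma not_sigma_bounded_in_cover:
  assumes "regular_space X" "Lindelof_space X" "A \<subseteq> topspace X" "\<not> sigma_bounded_in X A"
  shows "\<exists>G :: nat \<Rightarrow> 'a set. (\<forall>n. openin X (G n)) \<and> mono G \<and> (\<Union>n. G n) = topspace X \<and>
           (\<forall>n. \<not> A \<subseteq> X closure_of G n)"
proof -
  have "\<not> compactin X (X closure_of A)"
  proof
    assume "compactin X (X closure_of A)"
    then have "sigma_bounded_in X A"
      unfolding sigma_bounded_in_def using closure_of_subset[OF assms(3)]
      by (intro exI[of _ "\<lambda>_. X closure_of A"]) auto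
    then show False using assms(4) by simp
  qed
  then have "\<exists>\<U>. (\<forall>U\<in>\<U>. openin X U) \<and> X closure_of A \<subseteq> \<Union>\<U> \<and>
      (\<forall>\<F>. finite \<F> \<and> \<F> \<subseteq> \<U> \<longrightarrow> \<not> X closure_of A \<subseteq> \<Union>\<F>)"
    unfolding compactin_def using closure_of_subset_topspace[of X A] by meson
  then obtain \<U> where \<U>: "\<forall>U\<in>\<U>. openin X U" "X closure_of A \<subseteq> \<Union>\<U>"
    and nofin: "\<forall>\<F>. finite \<F> \<and> \<F> \<subseteq> \<U> \<longrightarrow> \<not> X closure_of A \<subseteq> \<Union>\<F>"
    by (elim exE conjE)
  define \<U>' where "\<U>' = insert (topspace X - X closure_of A) \<U>"
  have \<U>'_open: "openin X U" if "U \<in> \<U>'" for U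
    using that \<U>(1) unfolding \<U>'_def by auto
  have \<U>'_cover: "\<Union>\<U>' = topspace X"
  proof
    show "\<Union>\<U>' \<subseteq> topspace X" using \<U>'_open openin_subset by blast
    show "topspace X \<subseteq> \<Union>\<U>'" unfolding \<U>'_def using \<U>(2) by blast
  qed
  note \<U>' = \<U>'_cover \<U>'_open
  \<comment> \<open>A closed set containing \<open>A\<close> contains the closure of
    \<open>A\<close>. On that closure the added complement covers nothing, so dropping it would
    leave a finite subcover from the original family.\<close>
  have nofin': "\<not> A \<subseteq> X closure_of T" if "finite \<F>" "\<F> \<subseteq> \<U>'" "X closure_of T \<subseteq> \<Union>\<F>" for T \<F>
  proof
    assume "A \<subseteq> X closure_of T"
    then have "X closure_of A \<subseteq> X closure_of T" by (simp add: closure_of_minimal)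
    then have "X closure_of A \<subseteq> \<Union>(\<F> - {topspace X - X closure_of A})" using that(3) by blast
    moreover have "\<F> - {topspace X - X closure_of A} \<subseteq> \<U>"
      using that(2) unfolding \<U>'_def by blast
    ultimately show False using nofin that(1) by simp
  qed
  define \<V> where "\<V> = {V. openin X V \<and> (\<exists>U\<in>\<U>'. X closure_of V \<subseteq> U)}"
  have "topspace X \<subseteq> \<Union>\<V>"
  proof
    fix x assume x: "x \<in> topspace X"
    then obtain U where U: "U \<in> \<U>'" "x \<in> U" using \<U>' by blast
    then have "closedin X (topspace X - U)" "x \<in> topspace X - (topspace X - U)"
      using x \<U>' by auto
    then obtain V where V: "openin X V" "x \<in> V" "disjnt (topspace X - U) (X closure_of V)"
      using assms(1) unfolding regular_space by meson
    then have "X closure_of V \<subseteq> U"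
      using closure_of_subset_topspace[of X V] unfolding disjnt_def by blast
    then show "x \<in> \<Union>\<V>" unfolding \<V>_def using V U by blast
  qed
  moreover have "\<Union>\<V> \<subseteq> topspace X" unfolding \<V>_def using openin_subset by blast
  ultimately have "\<Union>\<V> = topspace X" by blast
  then obtain \<W> where \<W>: "countable \<W>" "\<W> \<subseteq> \<V>" "\<Union>\<W> = topspace X"
    using assms(2) unfolding Lindelof_space_def \<V>_def
    by (elim allE[where x = \<V>]) (auto simp: \<V>_def)
  \<comment> \<open>Inserting the empty set keeps the enumerated family nonempty, so that
    \<open>from_nat_into\<close> enumerates exactly this family.\<close>
  have "{} \<in> \<V>" using \<U>' unfolding \<V>_def \<U>'_def by auto
  define w where "w = from_nat_into (insert {} \<W>)"
  have w: "range w = insert {} \<W>" unfolding w_def using \<W>(1) by (simp add: range_from_nat_into)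
  have w\<V>: "w n \<in> \<V>" for n
  proof -
    have "w n \<in> insert {} \<W>" using w by auto
    then show ?thesis using \<W>(2) \<open>{} \<in> \<V>\<close> by auto
  qed
  then have "\<forall>n. \<exists>U\<in>\<U>'. X closure_of w n \<subseteq> U" unfolding \<V>_def by simp
  then obtain u where u: "\<And>n. u n \<in> \<U>'" "\<And>n. X closure_of w n \<subseteq> u n" by metis
  define G where "G n = (\<Union>i\<le>n. w i)" for n
  have "openin X (w n)" for n using w\<V>[of n] unfolding \<V>_def by simp
  then have "openin X (G n)" for n unfolding G_def by (intro openin_Union) auto
  moreover have "mono G" unfolding G_def by (intro monoI UN_mono) auto
  moreover have "(\<Union>n. G n) = topspace X"
  proof -
    have "(\<Union>n. G n) = \<Union>(range w)" unfolding G_def by blast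
    then show ?thesis using w \<W>(3) by simp
  qed
  moreover have "\<not> A \<subseteq> X closure_of G n" for n
  proof (rule nofin'[of "u ` {..n}"])
    show "X closure_of G n \<subseteq> \<Union>(u ` {..n})"
      unfolding G_def using u(2) by (subst closure_of_Union) auto
  qed (use u in auto)
  ultimately show ?thesis by (intro exI[of _ G]) simp
qed

text \<open>A Cantor-Bendixson argument: a countable base shows that the removed part
  \<open>D - P\<close> has a sigma-bounded image. So something remains, and if
  \<open>V \<inter> P\<close> had a sigma-bounded image, so would \<open>V \<inter> D\<close>, and
  \<open>V\<close> would contain no point of \<open>P\<close>.\<close>

lemma not_sigma_bounded_in_kernel:
  fixes f :: "'s::second_countable_topology \<Rightarrow> 'a"
  assumes "\<not> sigma_bounded_in X (f ` D)"
  defines "P \<equiv> {x \<in> D. \<forall>V. open V \<and> x \<in> V \<longrightarrow> \<not> sigma_bounded_in X (f ` (V \<inter> D))}"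
  shows "P \<noteq> {}" "\<And>V. open V \<Longrightarrow> V \<inter> P \<noteq> {} \<Longrightarrow> \<not> sigma_bounded_in X (f ` (V \<inter> P))"
proof -
  obtain \<B> :: "'s set set" where \<B>: "countable \<B>" "topological_basis \<B>"
    using ex_countable_basis by blast
  define \<S> where "\<S> = {V \<in> \<B>. sigma_bounded_in X (f ` (V \<inter> D))}"
  have D: "D - P \<subseteq> (\<Union>V\<in>\<S>. V \<inter> D)"
  proof
    fix x assume x: "x \<in> D - P"
    then obtain V where V: "open V" "x \<in> V" "sigma_bounded_in X (f ` (V \<inter> D))"
      unfolding P_def by blast
    then obtain V' where V': "V' \<in> \<B>" "x \<in> V'" "V' \<subseteq> V"
      using \<B>(2) topological_basisE by metis
    have "sigma_bounded_in X (f ` (V' \<inter> D))"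
      by (rule sigma_bounded_in_subset[OF V(3)]) (use V'(3) in auto)
    then show "x \<in> (\<Union>V\<in>\<S>. V \<inter> D)" unfolding \<S>_def using x V' by auto
  qed
  have "sigma_bounded_in X (\<Union>V\<in>\<S>. f ` (V \<inter> D))"
    by (rule sigma_bounded_in_countable_Union)
      (use \<B>(1) in \<open>auto simp: \<S>_def intro: countable_subset[of _ \<B>]\<close>)
  then have rest: "sigma_bounded_in X (f ` (D - P))"
    by (rule sigma_bounded_in_subset) (use D in blast)
  show "P \<noteq> {}" using rest assms(1) by auto
  fix V assume V: "open V" "V \<inter> P \<noteq> {}"
  show "\<not> sigma_bounded_in X (f ` (V \<inter> P))"
  proof
    assume b: "sigma_bounded_in X (f ` (V \<inter> P))"
    have "sigma_bounded_in X (\<Union>A\<in>{f ` (V \<inter> P), f ` (D - P)}. A)"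
      by (rule sigma_bounded_in_countable_Union) (use b rest in auto)
    then have "sigma_bounded_in X (f ` (V \<inter> D))"
      by (rule sigma_bounded_in_subset) auto
    then show False using V unfolding P_def by blast
  qed
qed

text \<open>A history \<open>h\<close> of TWO's answers determines an open set \<open>S h\<close> of
  reals meeting \<open>P\<close>. ONE plays a cover none of whose closures contains the image of
  \<open>S h \<inter> P\<close>, and after the answer \<open>n\<close> shrinks \<open>S h\<close> so
  that the image misses the \<open>n\<close>-th member. Along the run \<open>\<phi>\<close> that
  should defeat ONE, the shrinking sets converge on an irrational whose image is never
  covered.\<close>

lemma analytic_menger_imp_sigma_compact:
  assumes "regular_space X" "menger_space X" "analytic_space X"
  shows "sigma_compact_space X"
proof (rule ccontr)
  assume "\<not> sigma_compact_space X"
  then have not_bounded: "\<not> sigma_bounded_in X (topspace X)"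
    by (simp add: sigma_compact_space_iff_sigma_bounded_in)
  then have "topspace X \<noteq> {}"
    unfolding sigma_bounded_in_def by (auto intro!: exI[of _ "\<lambda>_. {}"])
  then obtain f where f: "continuous_map (top_of_set (- \<rat> :: real set)) X f"
    "f ` (- \<rat>) = topspace X"
    using assms(3) unfolding analytic_space_def by blast
  obtain q :: "nat \<Rightarrow> real" where q: "range q = \<rat>"
    using countable_rat range_from_nat_into[of "\<rat> :: real set"] Rats_0 by blast
  define P where
    "P = {x \<in> -\<rat>. \<forall>V. open V \<and> x \<in> V \<longrightarrow> \<not> sigma_bounded_in X (f ` (V \<inter> -\<rat>))}"
  have P: "P \<noteq> {}" "\<And>V. open V \<Longrightarrow> V \<inter> P \<noteq> {} \<Longrightarrow> \<not> sigma_bounded_in X (f ` (V \<inter> P))"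
    using not_sigma_bounded_in_kernel[of X f "-\<rat>"] not_bounded f(2)
    unfolding P_def by simp_all
  define cov where "cov V g \<longleftrightarrow> (\<forall>n. openin X (g n)) \<and> mono g \<and> (\<Union>n. g n) = topspace X \<and>
      (\<forall>n. \<not> f ` (V \<inter> P) \<subseteq> X closure_of g n)" for V and g :: "nat \<Rightarrow> 'a set"
  have "\<exists>g. cov V g" if "open V" "V \<inter> P \<noteq> {}" for V
    unfolding cov_def by (rule not_sigma_bounded_in_cover)
      (use assms P(2)[OF that] f(2) in \<open>auto simp: P_def menger_space_imp_Lindelof_space\<close>)
  then obtain G where cov: "\<And>V. open V \<Longrightarrow> V \<inter> P \<noteq> {} \<Longrightarrow> cov V (G V)"
    by metis
  have G: "openin X (G V n)" "mono (G V)" "(\<Union>n. G V n) = topspace X"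
      "\<not> f ` (V \<inter> P) \<subseteq> X closure_of G V n" if "open V" "V \<inter> P \<noteq> {}" for V n
    using cov[OF that] unfolding cov_def by auto
  \<comment> \<open>The move in round \<open>k\<close> after the answer \<open>n\<close>. Compact
    closures guarantee a limit point, leaving out the rational \<open>q k\<close> makes that point
    irrational, and the last conjunct keeps its image out of TWO's answer.\<close>
  define good where "good V n k V' \<longleftrightarrow> open V' \<and> V' \<inter> P \<noteq> {} \<and> compact (closure V') \<and>
      closure V' \<subseteq> V \<and> q k \<notin> closure V' \<and> f ` (V' \<inter> -\<rat>) \<inter> G V n = {}" for V n k V'
  have "\<exists>V'. good V n k V'" if V: "open V" "V \<inter> P \<noteq> {}" for V n k
  proof -
    \<comment> \<open>The image of \<open>y\<close> lies outside the closed set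
      \<open>X closure_of G V n\<close>, so continuity on the irrationals gives a ball around
      \<open>y\<close> whose irrational points are mapped outside it too.\<close>
    obtain y where y: "y \<in> V" "y \<in> P" "f y \<notin> X closure_of G V n"
      using G(4)[OF V] by blast
    have irr: "y \<in> -\<rat>" using y(2) unfolding P_def by simp
    define C where "C = X closure_of G V n"
    have "openin X (topspace X - C)"
      unfolding C_def by (intro openin_diff openin_topspace closedin_closure_of)
    then have "openin (top_of_set (-\<rat>)) {x \<in> -\<rat>. f x \<in> topspace X - C}"
      using f(1) unfolding continuous_map_def by auto
    then obtain T where T: "open T" "{x \<in> -\<rat>. f x \<in> topspace X - C} = -\<rat> \<inter> T"
      unfolding openin_open by blast
    have "f y \<in> topspace X" using f(2) irr by blast
    then have "y \<in> T" using T(2) irr y(3) unfolding C_def by blast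
    then have "y \<in> V \<inter> T \<inter> - {q k}" using y(1) irr q by auto
    moreover have "open (V \<inter> T \<inter> - {q k})" using T(1) V(1) by (intro open_Int) auto
    ultimately obtain e where e: "e > 0" "cball y e \<subseteq> V \<inter> T \<inter> - {q k}"
      using open_contains_cball by meson
    have cl: "closure (ball y e) = cball y e" using e(1) by simp
    have "G V n \<subseteq> C" unfolding C_def using G(1)[OF V] closure_of_subset openin_subset by metis
    moreover have "f x \<notin> C" if "x \<in> ball y e" "x \<in> -\<rat>" for x
      using that e(2) T(2) ball_subset_cball by blast
    ultimately have "f ` (ball y e \<inter> -\<rat>) \<inter> G V n = {}" by blast
    moreover have "ball y e \<inter> P \<noteq> {}" using y(2) e(1) centre_in_ball by blast
    ultimately have "good V n k (ball y e)"
      unfolding good_def cl using e(2) by auto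
    then show ?thesis ..
  qed
  then obtain nxt where nxt: "\<And>V n k. open V \<Longrightarrow> V \<inter> P \<noteq> {} \<Longrightarrow> good V n k (nxt V n k)"
    by metis
  \<comment> \<open>Histories are listed with the latest answer first; \<open>length h\<close> is
    the round, which decides the rational to be left out.\<close>
  define S where "S = rec_list UNIV (\<lambda>n h V. nxt V n (length h))"
  have S_simps: "S [] = UNIV" "S (n # h) = nxt (S h) n (length h)" for n h
    unfolding S_def by simp_all
  have S: "open (S h) \<and> S h \<inter> P \<noteq> {}" for h
  proof (induction h)
    case Nil
    then show ?case using P(1) by (simp add: S_simps)
  next
    case (Cons n h)
    then show ?case using nxt[of "S h" n "length h"] unfolding good_def S_simps by blast
  qed
  note GS = G[OF conjunct1[OF S] conjunct2[OF S]]
  have S_Cons: "good (S h) n (length h) (S (n # h))" for n h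
    using S nxt unfolding S_simps by blast
  \<comment> \<open>Adding \<open>F h m\<close>, the set selected by the previous answer
    \<open>m\<close>, gives the inclusion of earlier selections that the game lemma demands. It does
    no harm, since the image of the irrationals in \<open>S (m # h)\<close> already misses
    \<open>F h m\<close>.\<close>
  define F where "F = rec_list (G (S [])) (\<lambda>m h Fh n. G (S (m # h)) n \<union> Fh m)"
  have F_simps: "F [] = G (S [])" "F (m # h) n = G (S (m # h)) n \<union> F h m" for m h n
    unfolding F_def by simp_all
  have F_disj: "f ` (S (n # h) \<inter> -\<rat>) \<inter> F h n = {}" for h n
  proof (induction h arbitrary: n)
    case Nil
    then show ?case using S_Cons[of "[]" n] unfolding good_def F_simps by blast
  next
    case (Cons m h)
    have "S (n # m # h) \<subseteq> S (m # h)"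
      using S_Cons[of "m # h" n] closure_subset unfolding good_def by blast
    then have "f ` (S (n # m # h) \<inter> -\<rat>) \<inter> F h m = {}" using Cons[of m] by blast
    then show ?case using S_Cons[of "m # h" n] unfolding good_def F_simps by blast
  qed
  have F_open: "openin X (F h n)" for h n
  proof (induction h arbitrary: n)
    case Nil
    then show ?case using GS(1) by (simp add: F_simps)
  next
    case (Cons m h)
    then show ?case using GS(1) by (simp add: F_simps openin_Un)
  qed
  have "\<exists>\<phi>::nat \<Rightarrow> nat. \<forall>x\<in>topspace X. \<exists>k. x \<in> F (rev (map \<phi> [0..<k])) (\<phi> k)"
  proof (rule menger_space_defeats_strategy[OF assms(2) F_open])
    fix h
    have "G (S h) n \<subseteq> F h n" for n
      by (cases h) (auto simp: F_simps)
    then have "(\<Union>n. G (S h) n) \<subseteq> (\<Union>n. F h n)" by (rule UN_mono[OF subset_refl])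
    then have "topspace X \<subseteq> (\<Union>n. F h n)" by (simp only: GS(3))
    moreover have "F h n \<subseteq> topspace X" for n
      using F_open by (rule openin_subset)
    ultimately show "(\<Union>n. F h n) = topspace X" by blast
  next
    fix h and m n :: nat assume "m \<le> n"
    then have "G (S h) m \<subseteq> G (S h) n" by (rule monoD[OF GS(2)])
    then show "F h m \<subseteq> F h n" by (cases h) (auto simp: F_simps)
  next
    fix h m n show "F h m \<subseteq> F (m # h) n" by (simp add: F_simps)
  qed
  then obtain \<phi> :: "nat \<Rightarrow> nat"
    where \<phi>: "\<And>x. x \<in> topspace X \<Longrightarrow> \<exists>k. x \<in> F (rev (map \<phi> [0..<k])) (\<phi> k)"
    by blast
  define H where "H k = rev (map \<phi> [0..<k])" for k
  have H_Suc: "H (Suc k) = \<phi> k # H k" "length (H k) = k" for k unfolding H_def by simp_all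
  have step: "good (S (H k)) (\<phi> k) k (S (H (Suc k)))" for k
    using S_Cons[of "H k" "\<phi> k"] by (simp add: H_Suc)
  \<comment> \<open>The index is shifted: \<open>C k\<close> is the closure of the set chosen in
    round \<open>k\<close>. It still lies inside the open set \<open>S (H k)\<close>, which makes
    the \<open>C k\<close> decreasing.\<close>
  define C where "C k = closure (S (H (Suc k)))" for k
  have C_sub: "C k \<subseteq> S (H k)" "compact (C k)" "q k \<notin> C k" for k
    using step[of k] unfolding good_def C_def by auto
  have "C (Suc k) \<subseteq> C k" for k
    using C_sub(1)[of "Suc k"] closure_subset unfolding C_def by blast
  then have "decseq C" by (simp add: decseq_Suc_iff)
  have "C k \<noteq> {}" for k using S[of "H (Suc k)"] unfolding C_def by auto
  then have "\<Inter>(range C) \<noteq> {}"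
    using compact_nest[of C] C_sub(2) \<open>decseq C\<close>[unfolded decseq_def] by blast
  then obtain x where x: "\<And>k. x \<in> C k" by blast
  have "x \<notin> range q" using x C_sub(3) by (metis imageE)
  then have irr: "x \<in> -\<rat>" using q by simp
  then have "f x \<in> topspace X" using f(2) by blast
  then obtain k where k: "f x \<in> F (H k) (\<phi> k)" using \<phi> unfolding H_def by blast
  have "x \<in> S (\<phi> k # H k)" using x[of "Suc k"] C_sub(1)[of "Suc k"] by (auto simp: H_Suc)
  then show False using F_disj[of "\<phi> k" "H k"] k irr by blast
qed

section \<open>Countable ordinals and the \<open>\<sigma>\<close>-projective sets\<close>

lemma wo_rel_omega1: "wo_rel omega1"
  using cardSuc_Card_order[OF natLeq_Card_order]
  by (simp add: omega1_def wo_rel_def card_order_on_def)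

lemma omega1_underS_trans: "\<alpha> \<in> underS omega1 \<beta> \<Longrightarrow> (\<beta>, \<gamma>) \<in> omega1 \<Longrightarrow> \<alpha> \<in> underS omega1 \<gamma>"
  using underS_incr[of omega1 \<beta> \<gamma>] wo_rel.TRANS[OF wo_rel_omega1] wo_rel.ANTISYM[OF wo_rel_omega1]
  by blast

lemma omega1_underS_Field: "\<alpha> \<in> underS omega1 \<beta> \<Longrightarrow> \<alpha> \<in> Field omega1"
  unfolding underS_def Field_def by blast

lemma omega1_minimal:
  assumes "\<beta> \<in> Field omega1" "P \<beta>"
  obtains \<gamma> where "\<gamma> \<in> Field omega1" "P \<gamma>" "\<And>\<delta>. \<delta> \<in> underS omega1 \<gamma> \<Longrightarrow> \<not> P \<delta>"
proof -
  define M where "M = {\<delta> \<in> Field omega1. P \<delta>}"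
  have M: "M \<subseteq> Field omega1" "M \<noteq> {}" unfolding M_def using assms by auto
  define \<gamma> where "\<gamma> = wo_rel.minim omega1 M"
  have \<gamma>: "\<gamma> \<in> M" unfolding \<gamma>_def using wo_rel.minim_in[OF wo_rel_omega1 M] .
  have "\<not> P \<delta>" if "\<delta> \<in> underS omega1 \<gamma>" for \<delta>
  proof
    assume "P \<delta>"
    then have "\<delta> \<in> M" unfolding M_def using that omega1_underS_Field by simp
    then have "(\<gamma>, \<delta>) \<in> omega1"
      unfolding \<gamma>_def using wo_rel.minim_least[OF wo_rel_omega1 M(1)] by blast
    then show False
      using that wo_rel.ANTISYM[OF wo_rel_omega1] unfolding underS_def antisym_def by blast
  qed
  then show thesis using that \<gamma> unfolding M_def by blast
qed

lemma omega1_no_max: "\<alpha> \<in> Field omega1 \<Longrightarrow> \<exists>\<beta>\<in>Field omega1. \<alpha> \<in> underS omega1 \<beta>"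
  unfolding omega1_def underS_def
  using infinite_Card_order_limit[OF cardSuc_Card_order[OF natLeq_Card_order], of \<alpha>]
    cardSuc_finite[OF natLeq_Card_order] Field_natLeq by auto

text \<open>Regularity of the successor cardinal: a countable set covered by the increasing chain of
  initial segments lies in one of them.\<close>

lemma omega1_bounded:
  fixes \<alpha> :: "nat \<Rightarrow> nat set"
  assumes "\<And>n. \<alpha> n \<in> Field omega1"
  shows "\<exists>\<gamma>\<in>Field omega1. \<forall>n. \<alpha> n \<in> underS omega1 \<gamma>"
proof -
  have "\<exists>i\<in>Field (cardSuc natLeq). range \<alpha> \<subseteq> underS omega1 i"
  proof (rule cardSuc_UNION[OF natLeq_Card_order])
    show "infinite (Field natLeq)" by (simp add: Field_natLeq)
    show "relChain (cardSuc natLeq) (underS omega1)"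
      unfolding relChain_def using omega1_underS_trans by (auto simp: omega1_def)
    show "range \<alpha> \<subseteq> (\<Union>i\<in>Field (cardSuc natLeq). underS omega1 i)"
      using omega1_no_max[OF assms] by (auto simp: omega1_def)
    show "(card_of (range \<alpha>), natLeq) \<in> ordLeq"
      using card_of_image[of \<alpha> UNIV] card_of_nat ordLeq_ordIso_trans by blast
  qed
  then show ?thesis by (auto simp: omega1_def)
qed

text \<open>Take for \<open>\<gamma>\<close> the least element strictly above
  \<open>\<alpha>\<close>.\<close>

lemma omega1_successor:
  assumes "\<alpha> \<in> Field omega1"
  shows "\<exists>\<gamma>\<in>Field omega1. underS omega1 \<gamma> = under omega1 \<alpha>"
proof -
  obtain \<beta> where "\<beta> \<in> Field omega1" "\<alpha> \<in> underS omega1 \<beta>"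
    using omega1_no_max[OF assms] by blast
  then obtain \<gamma> where \<gamma>: "\<gamma> \<in> Field omega1" "\<alpha> \<in> underS omega1 \<gamma>"
      "\<And>\<delta>. \<delta> \<in> underS omega1 \<gamma> \<Longrightarrow> \<alpha> \<notin> underS omega1 \<delta>"
    using omega1_minimal[of \<beta> "\<lambda>\<gamma>. \<alpha> \<in> underS omega1 \<gamma>"] by blast
  have "underS omega1 \<gamma> = under omega1 \<alpha>"
  proof (intro equalityI subsetI)
    fix \<delta> assume \<delta>: "\<delta> \<in> underS omega1 \<gamma>"
    then have "\<delta> \<in> Field omega1" by (rule omega1_underS_Field)
    then have "(\<delta>, \<alpha>) \<in> omega1 \<or> \<alpha> \<in> underS omega1 \<delta>"
      using assms wo_rel.TOTALS[OF wo_rel_omega1] unfolding underS_def by blast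
    then show "\<delta> \<in> under omega1 \<alpha>" using \<gamma>(3)[OF \<delta>] unfolding under_def by blast
  next
    fix \<delta> assume "\<delta> \<in> under omega1 \<alpha>"
    then have "\<delta> = \<alpha> \<or> \<delta> \<in> underS omega1 \<alpha>" unfolding under_def underS_def by blast
    then show "\<delta> \<in> underS omega1 \<gamma>"
      using \<gamma>(2) omega1_underS_trans unfolding underS_def by blast
  qed
  then show ?thesis using \<gamma>(1) by blast
qed

text \<open>The hierarchy takes countable unions at limit levels only, so a mere upper bound is not
  enough. The witness is the least element above a strictly increasing sequence
  \<open>\<beta>\<close> that starts at an upper bound of the \<open>\<alpha> n\<close>.\<close>

lemma omega1_limit_above:
  fixes \<alpha> :: "nat \<Rightarrow> nat set"
  assumes "\<And>n. \<alpha> n \<in> Field omega1"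
  shows "\<exists>\<gamma>\<in>Field omega1. (\<forall>n. \<alpha> n \<in> underS omega1 \<gamma>) \<and>
           \<not> (\<exists>\<beta>\<in>underS omega1 \<gamma>. underS omega1 \<gamma> = under omega1 \<beta>)"
proof -
  obtain b where b: "b \<in> Field omega1" "\<And>n. \<alpha> n \<in> underS omega1 b"
    using omega1_bounded[of \<alpha>] assms by blast
  obtain nx where nx: "\<And>\<beta>. \<beta> \<in> Field omega1 \<Longrightarrow> nx \<beta> \<in> Field omega1"
      "\<And>\<beta>. \<beta> \<in> Field omega1 \<Longrightarrow> \<beta> \<in> underS omega1 (nx \<beta>)"
    using omega1_no_max by metis
  define \<beta> where "\<beta> k = (nx ^^ k) b" for k
  have \<beta>: "\<beta> k \<in> Field omega1" for k unfolding \<beta>_def by (induction k) (auto simp: b nx)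
  have \<beta>_Suc: "\<beta> k \<in> underS omega1 (\<beta> (Suc k))" for k
    using nx(2)[OF \<beta>[of k]] unfolding \<beta>_def by simp
  obtain c where "c \<in> Field omega1" "\<forall>k. \<beta> k \<in> underS omega1 c"
    using omega1_bounded[of \<beta>] \<beta> by blast
  then obtain \<gamma> where \<gamma>: "\<gamma> \<in> Field omega1" "\<forall>k. \<beta> k \<in> underS omega1 \<gamma>"
      "\<And>\<delta>. \<delta> \<in> underS omega1 \<gamma> \<Longrightarrow> \<not> (\<forall>k. \<beta> k \<in> underS omega1 \<delta>)"
    using omega1_minimal[of c "\<lambda>\<gamma>. \<forall>k. \<beta> k \<in> underS omega1 \<gamma>"] by blast
  have "b \<in> underS omega1 \<gamma>" using \<gamma>(2) unfolding \<beta>_def by (metis funpow_0)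
  then have "\<alpha> n \<in> underS omega1 \<gamma>" for n
    using omega1_underS_trans[OF b(2)] unfolding underS_def by blast
  moreover have False if \<delta>: "\<delta> \<in> underS omega1 \<gamma>" "underS omega1 \<gamma> = under omega1 \<delta>" for \<delta>
  proof -
    \<comment> \<open>If \<open>\<gamma>\<close> were the successor of \<open>\<delta>\<close>, some
      \<open>\<beta> k\<close> would fail to be below \<open>\<delta>\<close> by minimality, yet
      \<open>\<beta> (Suc k)\<close> would be at most \<open>\<delta>\<close>.\<close>
    obtain k where k: "\<beta> k \<notin> underS omega1 \<delta>" using \<gamma>(3)[OF \<delta>(1)] by blast
    have "\<beta> (Suc k) \<in> under omega1 \<delta>" using \<gamma>(2) \<delta>(2) by blast
    then show False using k omega1_underS_trans[OF \<beta>_Suc] unfolding under_def by blast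
  qed
  ultimately show ?thesis using \<gamma>(1) by blast
qed

text \<open>The union at \<open>omega1\<close> yields nothing beyond the countable levels: countably
  many of these lie below a common limit level, whose clause already contains the union.\<close>

lemma sigma_projective_iff: "sigma_projective A \<longleftrightarrow> (\<exists>\<alpha>\<in>Field omega1. A \<in> Sigma1 \<alpha>)"
proof
  assume "sigma_projective A"
  then obtain F :: "nat \<Rightarrow> 'a set" where F: "\<forall>n. \<exists>\<alpha>\<in>Field omega1. F n \<in> Sigma1 \<alpha>" "A = (\<Union>n. F n)"
    unfolding sigma_projective_def by blast
  obtain \<alpha> where \<alpha>: "\<And>n. \<alpha> n \<in> Field omega1" "\<And>n. F n \<in> Sigma1 (\<alpha> n)"
    using F(1) by metis
  obtain \<gamma> where \<gamma>: "\<gamma> \<in> Field omega1" "\<And>n. \<alpha> n \<in> underS omega1 \<gamma>"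
      "\<not> (\<exists>\<beta>\<in>underS omega1 \<gamma>. underS omega1 \<gamma> = under omega1 \<beta>)"
    using omega1_limit_above[of \<alpha>] \<alpha>(1) by blast
  have "underS omega1 \<gamma> \<noteq> {}" using \<gamma>(2) by blast
  then have "Sigma1 \<gamma> = {\<Union>n::nat. B n |B. \<forall>n. \<exists>\<beta>\<in>underS omega1 \<gamma>. B n \<in> (Sigma1 \<beta> :: 'a set set)}"
    unfolding Sigma1_rec[of \<gamma>] Sigma1_step_def using \<gamma>(3) by simp
  moreover have "\<forall>n. \<exists>\<beta>\<in>underS omega1 \<gamma>. F n \<in> Sigma1 \<beta>" using \<gamma>(2) \<alpha>(2) by blast
  ultimately have "A \<in> Sigma1 \<gamma>" using F(2) by blast
  then show "\<exists>\<alpha>\<in>Field omega1. A \<in> Sigma1 \<alpha>" using \<gamma>(1) by blast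
next
  assume "\<exists>\<alpha>\<in>Field omega1. A \<in> Sigma1 \<alpha>"
  then show "sigma_projective A"
    unfolding sigma_projective_def by (intro exI[of _ "\<lambda>_. A"]) simp
qed

section \<open>Closure properties of the sigma-projective sets\<close>

lemma sigma_projective_UN_nat:
  fixes A :: "nat \<Rightarrow> 'a::topological_space set"
  assumes "\<And>n. sigma_projective (A n)"
  shows "sigma_projective (\<Union>n. A n)"
  unfolding sigma_projective_def
  using assms unfolding sigma_projective_iff by (intro exI[of _ A]) simp

lemma sigma_projective_empty: "sigma_projective {}"
proof -
  have "Field omega1 \<noteq> {}"
    using cardSuc_finite[OF natLeq_Card_order] Field_natLeq by (force simp: omega1_def)
  then obtain \<beta> where "\<beta> \<in> Field omega1" by blast
  then obtain \<gamma> where \<gamma>: "\<gamma> \<in> Field omega1" "\<And>\<delta>. \<delta> \<in> underS omega1 \<gamma> \<Longrightarrow> \<not> True"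
    using omega1_minimal[of \<beta> "\<lambda>_. True"] by blast
  then have "underS omega1 \<gamma> = {}" by blast
  then have "{} \<in> Sigma1 \<gamma>"
    unfolding Sigma1_rec[of \<gamma>] Sigma1_step_def by (simp add: analytic_space_def)
  then show ?thesis using \<gamma>(1) sigma_projective_iff by blast
qed

text \<open>The successor clause, used one level above that of \<open>- A\<close>. With the identity
  for \<open>f\<close> it gives closure under complements, and from there closure under continuous
  images.\<close>

lemma sigma_projective_image_Compl:
  fixes f :: "'a::topological_space \<Rightarrow> 'a"
  assumes "sigma_projective (- A)" "continuous_on A f"
  shows "sigma_projective (f ` A)"
proof -
  obtain \<alpha> where \<alpha>: "\<alpha> \<in> Field omega1" "- A \<in> Sigma1 \<alpha>"
    using assms(1) sigma_projective_iff by blast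
  obtain \<gamma> where \<gamma>: "\<gamma> \<in> Field omega1" "underS omega1 \<gamma> = under omega1 \<alpha>"
    using omega1_successor[OF \<alpha>(1)] by blast
  have \<alpha>\<gamma>: "\<alpha> \<in> underS omega1 \<gamma>"
    using \<gamma>(2) Refl_under_in[OF wo_rel.REFL[OF wo_rel_omega1] \<alpha>(1)] by simp
  then have ne: "underS omega1 \<gamma> \<noteq> {}" by blast
  have ex: "\<exists>\<beta>\<in>underS omega1 \<gamma>. underS omega1 \<gamma> = under omega1 \<beta>"
    using \<alpha>\<gamma> \<gamma>(2) by blast
  have "Sigma1 \<gamma> = {f ` A |(f :: 'a \<Rightarrow> 'a) A. continuous_on A f \<and>
      (\<exists>\<beta>\<in>underS omega1 \<gamma>. underS omega1 \<gamma> = under omega1 \<beta> \<and> - A \<in> Sigma1 \<beta>)}"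
    unfolding Sigma1_rec[of \<gamma>] Sigma1_step_def if_not_P[OF ne] if_P[OF ex] ..
  then have "f ` A \<in> Sigma1 \<gamma>" using assms(2) \<alpha>(2) \<alpha>\<gamma> \<gamma>(2) by blast
  then show ?thesis using \<gamma>(1) sigma_projective_iff by blast
qed

lemma sigma_projective_Compl: "sigma_projective A \<Longrightarrow> sigma_projective (- A)"
  using sigma_projective_image_Compl[of "- A" "\<lambda>x. x"] by simp

lemma sigma_projective_image:
  fixes f :: "'a::topological_space \<Rightarrow> 'a"
  shows "sigma_projective A \<Longrightarrow> continuous_on A f \<Longrightarrow> sigma_projective (f ` A)"
  using sigma_projective_image_Compl sigma_projective_Compl by blast

lemma sigma_projective_Un:
  assumes "sigma_projective A" "sigma_projective B"
  shows "sigma_projective (A \<union> B)"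
proof -
  have "sigma_projective (\<Union>n::nat. if n = 0 then A else B)"
    by (rule sigma_projective_UN_nat) (use assms in auto)
  moreover have "(\<Union>n::nat. if n = 0 then A else B) = A \<union> B"
    by (auto split: if_splits)
  ultimately show ?thesis by simp
qed

lemma sigma_projective_Int:
  assumes "sigma_projective A" "sigma_projective B"
  shows "sigma_projective (A \<inter> B)"
proof -
  have "sigma_projective (- (- A \<union> - B))"
    using assms by (intro sigma_projective_Compl sigma_projective_Un)
  then show ?thesis by simp
qed

lemma continuous_on_coordinate_fun:
  fixes F :: "nat \<Rightarrow> 'b::topological_space"
  shows "continuous_on S (\<lambda>x :: nat \<Rightarrow> nat. F (x i))"
proof -
  have "continuous_on S (\<lambda>x :: nat \<Rightarrow> nat. x i)"
    by (rule continuous_on_subset[OF continuous_on_product_coordinates subset_UNIV])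
  then show ?thesis
    using continuous_on_compose2[OF Topological_Spaces.continuous_on_discrete[of UNIV F]] by blast
qed

text \<open>The Borel sets are generated by the conditions on a single coordinate. A nonempty set of
  this kind is a retract of the Baire space, hence a continuous image of the complement of the empty
  set.\<close>

lemma sigma_projective_borel:
  fixes A :: "(nat \<Rightarrow> nat) set"
  assumes "A \<in> sets borel"
  shows "sigma_projective A"
proof -
  have "A \<in> sigma_sets UNIV {{x. x i \<in> N} |i N. True}"
    using assms unfolding sets_PiM_equal_borel[symmetric] sets_PiM_single
    by (rule rev_subsetD) (auto simp: PiE_UNIV_domain intro!: sigma_sets_mono')
  then show ?thesis
  proof induction
    case (Basic A)
    then obtain i N where A: "A = {x. x i \<in> N}" by blast
    show ?case
    proof (cases "N = {}")
      case True
      then show ?thesis using A sigma_projective_empty by simp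
    next
      case False
      then obtain a where a: "a \<in> N" by blast
      \<comment> \<open>The retraction replaces a forbidden value at coordinate \<open>i\<close> by
        a fixed allowed one.\<close>
      define r where "r x = x(i := if x i \<in> N then x i else a)" for x :: "nat \<Rightarrow> nat"
      have "continuous_on UNIV (\<lambda>x. r x j)" for j
        unfolding r_def fun_upd_def
        using continuous_on_coordinate_fun[of UNIV "\<lambda>v. if v \<in> N then v else a" i]
        by (cases "j = i") simp_all
      then have "continuous_on UNIV r" by (rule continuous_on_coordinatewise_then_product)
      moreover have "range r = A"
      proof
        show "range r \<subseteq> A" unfolding r_def A using a by auto
        show "A \<subseteq> range r"
        proof
          fix x assume "x \<in> A"
          then have "r x = x" unfolding r_def A by auto
          then show "x \<in> range r" by (metis rangeI)
        qed
      qed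
      ultimately show ?thesis
        using sigma_projective_image_Compl[of UNIV r] sigma_projective_empty by simp
    qed
  next
    case Empty
    then show ?case by (rule sigma_projective_empty)
  next
    case (Compl A)
    then show ?case using sigma_projective_Compl by (simp add: Compl_eq_Diff_UNIV)
  next
    case (Union A)
    then show ?case by (intro sigma_projective_UN_nat)
  qed
qed

section \<open>Preimages in the Baire space\<close>

text \<open>Coordinate 0 codes the integer part and the later ones, cut off at 1, are binary digits.
  Every real thus has a code whose later coordinates are at most 1, and such codes with a bounded
  first coordinate lie in a compact set.\<close>

definition baire_real :: "(nat \<Rightarrow> nat) \<Rightarrow> real" where
  "baire_real y = of_int (int_decode (y 0)) + (\<Sum>i. real (min 1 (y (Suc i))) / 2 ^ Suc i)"

lemma continuous_on_baire_real: "continuous_on UNIV baire_real"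
proof -
  have "uniform_limit UNIV (\<lambda>n (y :: nat \<Rightarrow> nat). \<Sum>i<n. real (min 1 (y (Suc i))) / 2 ^ Suc i)
      (\<lambda>y. \<Sum>i. real (min 1 (y (Suc i))) / 2 ^ Suc i) sequentially"
  proof (rule Weierstrass_m_test)
    show "norm (real (min 1 (y (Suc i))) / 2 ^ Suc i) \<le> (1 / 2) ^ Suc i" for i and y :: "nat \<Rightarrow> nat"
      by (simp add: field_simps)
    show "summable (\<lambda>i. (1 / 2 :: real) ^ Suc i)"
      by (subst summable_Suc_iff) (simp add: summable_geometric)
  qed
  then have "continuous_on UNIV (\<lambda>y :: nat \<Rightarrow> nat. \<Sum>i. real (min 1 (y (Suc i))) / 2 ^ Suc i)"
  proof (rule uniform_limit_theorem[rotated])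
    show "\<forall>\<^sub>F n in sequentially. continuous_on UNIV
        (\<lambda>y :: nat \<Rightarrow> nat. \<Sum>i<n. real (min 1 (y (Suc i))) / 2 ^ Suc i)"
      by (intro always_eventually allI continuous_on_sum continuous_on_coordinate_fun)
  qed simp
  then show ?thesis
    unfolding baire_real_def by (intro continuous_on_add continuous_on_coordinate_fun)
qed

lemma baire_real_surj:
  obtains y where "baire_real y = x" "\<And>i. y (Suc i) \<le> 1"
proof -
  define t where "t = frac x"
  \<comment> \<open>The binary digits of the fractional part. The difference of floors is 0 or 1,
    and the partial sums telescope to \<open>\<lfloor>2 ^ n * t\<rfloor> / 2 ^ n\<close>.\<close>
  define d where "d i = nat (\<lfloor>2 ^ Suc i * t\<rfloor> - 2 * \<lfloor>2 ^ i * t\<rfloor>)" for i :: nat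
  have t: "0 \<le> t" "t < 1" unfolding t_def by (simp_all add: frac_lt_1)
  have floor_double: "\<lfloor>2 * u\<rfloor> - 2 * \<lfloor>u\<rfloor> = 0 \<or> \<lfloor>2 * u\<rfloor> - 2 * \<lfloor>u\<rfloor> = 1" for u :: real
    by linarith
  have d: "int (d i) = \<lfloor>2 ^ Suc i * t\<rfloor> - 2 * \<lfloor>2 ^ i * t\<rfloor>" "d i \<le> 1" for i
    using floor_double[of "2 ^ i * t"] unfolding d_def by (auto simp: mult.assoc)
  have sum: "(\<Sum>i<n. real (d i) / 2 ^ Suc i) = of_int \<lfloor>2 ^ n * t\<rfloor> / 2 ^ n" for n
  proof (induction n)
    case 0
    then show ?case using t by (simp add: floor_eq_iff)
  next
    case (Suc n)
    have "real (d n) = of_int (int (d n))" by simp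
    also have "\<dots> = of_int \<lfloor>2 ^ Suc n * t\<rfloor> - 2 * of_int \<lfloor>2 ^ n * t\<rfloor>"
      unfolding d(1) by simp
    finally show ?case using Suc by (simp add: field_simps)
  qed
  have "(\<lambda>n. of_int \<lfloor>2 ^ n * t\<rfloor> / 2 ^ n) \<longlonglongrightarrow> t"
  proof (rule tendsto_sandwich)
    show "(\<lambda>n. t - (1 / 2) ^ n) \<longlonglongrightarrow> t"
      using tendsto_diff[OF tendsto_const LIMSEQ_power_zero[of "1 / 2 :: real"], of t] by simp
    have "(2 ^ n * t - 1) / 2 ^ n \<le> of_int \<lfloor>2 ^ n * t\<rfloor> / 2 ^ n" for n
      by (intro divide_right_mono) (linarith, simp)
    then show "\<forall>\<^sub>F n in sequentially. t - (1 / 2) ^ n \<le> of_int \<lfloor>2 ^ n * t\<rfloor> / 2 ^ n"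
      by (simp add: field_simps)
    have "of_int \<lfloor>2 ^ n * t\<rfloor> / 2 ^ n \<le> (2 ^ n * t) / 2 ^ n" for n
      by (intro divide_right_mono) (linarith, simp)
    then show "\<forall>\<^sub>F n in sequentially. of_int \<lfloor>2 ^ n * t\<rfloor> / 2 ^ n \<le> t" by simp
  qed simp
  then have "(\<lambda>i. real (d i) / 2 ^ Suc i) sums t"
    unfolding sums_def sum .
  then have suminf: "(\<Sum>i. real (d i) / 2 ^ Suc i) = t" by (rule sums_unique[symmetric])
  define y where "y i = (case i of 0 \<Rightarrow> int_encode \<lfloor>x\<rfloor> | Suc j \<Rightarrow> d j)" for i
  have "min 1 (d i) = d i" for i using d(2)[of i] by simp
  then have "baire_real y = x"
    unfolding baire_real_def y_def using suminf by (simp add: t_def frac_def)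
  moreover have "y (Suc i) \<le> 1" for i unfolding y_def using d(2) by simp
  ultimately show thesis by (rule that)
qed

lemma continuous_on_reindex: "continuous_on S (\<lambda>z :: nat \<Rightarrow> nat. \<lambda>n. z (\<tau> n))"
  by (rule continuous_on_coordinatewise_then_product) (rule continuous_on_coordinate_fun)

text \<open>The set is the projection of all pairs of \<open>x\<close> and \<open>c \<in> C\<close>
  with \<open>f c = h x\<close>. A pair is coded by one sequence, with \<open>x\<close> at the even
  places and a \<open>baire_real\<close> code of \<open>c\<close> at the odd ones, so that the
  projection is a continuous self-map of the Baire space.\<close>

lemma sigma_projective_vimage_image:
  fixes f :: "real \<Rightarrow> real" and h :: "(nat \<Rightarrow> nat) \<Rightarrow> real"
  assumes f: "continuous_on C f" and h: "continuous_on UNIV h"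
    and C: "\<And>r :: (nat \<Rightarrow> nat) \<Rightarrow> real. continuous_on UNIV r \<Longrightarrow> sigma_projective (r -` C)"
  shows "sigma_projective (h -` (f ` C))"
proof -
  define ev :: "(nat \<Rightarrow> nat) \<Rightarrow> nat \<Rightarrow> nat" where "ev z = (\<lambda>n. z (2 * n))" for z
  define r where "r z = baire_real (\<lambda>n. z (2 * n + 1))" for z
  have r: "continuous_on UNIV r"
    unfolding r_def
    by (rule continuous_on_compose2[OF continuous_on_baire_real continuous_on_reindex]) simp
  have ev: "continuous_on S ev" for S unfolding ev_def by (rule continuous_on_reindex)
  define E where "E = r -` C"
  have E: "sigma_projective E" unfolding E_def using C[OF r] .
  have "continuous_on E (\<lambda>z. f (r z))"
    by (rule continuous_on_compose2[OF f continuous_on_subset[OF r subset_UNIV]]) (auto simp: E_def)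
  moreover have "continuous_on E (\<lambda>z. h (ev z))"
    by (rule continuous_on_compose2[OF h ev]) simp
  ultimately have "continuous_on E (\<lambda>z. f (r z) - h (ev z))"
    by (rule continuous_on_diff)
  \<comment> \<open>Since \<open>f\<close> is continuous on \<open>C\<close> only, the equation is
    closed relative to \<open>E\<close>; it is written as \<open>E \<inter> T\<close> with
    \<open>T\<close> closed, hence Borel.\<close>
  then have "closedin (top_of_set E) {z \<in> E. f (r z) - h (ev z) = 0}"
    by (rule continuous_closedin_preimage_constant)
  then obtain T where T: "closed T" "{z \<in> E. f (r z) - h (ev z) = 0} = E \<inter> T"
    unfolding closedin_closed by blast
  have "sigma_projective (E \<inter> T)"
    using sigma_projective_Int[OF E sigma_projective_borel[OF borel_closed[OF T(1)]]] .
  then have "sigma_projective (ev ` (E \<inter> T))"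
    using ev by (rule sigma_projective_image)
  moreover have "ev ` (E \<inter> T) = h -` (f ` C)"
    unfolding T(2)[symmetric]
  proof (intro equalityI subsetI)
    fix x assume "x \<in> ev ` {z \<in> E. f (r z) - h (ev z) = 0}"
    then obtain z where "x = ev z" "r z \<in> C" "h (ev z) = f (r z)" unfolding E_def by auto
    then show "x \<in> h -` (f ` C)" by simp
  next
    fix x assume "x \<in> h -` (f ` C)"
    then obtain c where c: "c \<in> C" "h x = f c" by auto
    obtain w where w: "baire_real w = c" using baire_real_surj by metis
    define z where "z n = (if even n then x (n div 2) else w (n div 2))" for n
    have "ev z = x" "r z = c" unfolding ev_def r_def z_def using w by simp_all
    then have "z \<in> {z \<in> E. f (r z) - h (ev z) = 0}" unfolding E_def using c by simp
    then show "x \<in> ev ` {z \<in> E. f (r z) - h (ev z) = 0}" using \<open>ev z = x\<close> by blast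
  qed
  ultimately show ?thesis by simp
qed

text \<open>Determinacy concerns payoff sets in the Baire space, whereas \<open>B\<close> is a set
  of reals; this carries the hierarchy across. At the least level the set is an image of the
  irrationals, whose continuous preimages are Borel, so the image lemma serves there as well as at
  successors.\<close>

lemma sigma_projective_vimage_Sigma1:
  fixes h :: "(nat \<Rightarrow> nat) \<Rightarrow> real"
  assumes "A \<in> Sigma1 \<alpha>" "continuous_on UNIV h"
  shows "sigma_projective (h -` A)"
  using assms
proof (induction \<alpha> arbitrary: A h rule: wo_rel.well_order_induct[OF wo_rel_omega1])
  case (1 \<alpha>)
  have IH: "sigma_projective (r -` D)"
    if "\<beta> \<in> underS omega1 \<alpha>" "D \<in> Sigma1 \<beta>" "continuous_on UNIV r" for \<beta> D and r :: "(nat \<Rightarrow> nat) \<Rightarrow> real"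
    using 1(1) that unfolding underS_def by blast
  consider "underS omega1 \<alpha> = {}"
    | "underS omega1 \<alpha> \<noteq> {}" "\<exists>\<beta>\<in>underS omega1 \<alpha>. underS omega1 \<alpha> = under omega1 \<beta>"
    | "underS omega1 \<alpha> \<noteq> {}" "\<not> (\<exists>\<beta>\<in>underS omega1 \<alpha>. underS omega1 \<alpha> = under omega1 \<beta>)"
    by blast
  then show ?case
  proof cases
    case zero: 1
    have "analytic_space (top_of_set A)"
      using 1(2) unfolding Sigma1_rec[of \<alpha>] Sigma1_step_def if_P[OF zero] by simp
    then consider "A = {}" | f where "continuous_on (- \<rat> :: real set) f" "f ` (- \<rat>) = A"
      unfolding analytic_space_def by (auto simp: continuous_map_in_subtopology)
    then show ?thesis
    proof cases
      case 1
      then show ?thesis using sigma_projective_empty by simp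
    next
      case 2
      have "sigma_projective (r -` (- \<rat>))" if "continuous_on UNIV r" for r :: "(nat \<Rightarrow> nat) \<Rightarrow> real"
      proof (rule sigma_projective_borel)
        have "r \<in> borel_measurable borel" using that by (rule borel_measurable_continuous_onI)
        moreover have "(- \<rat> :: real set) \<in> sets borel"
          by (intro borel_comp sets.countable[OF _ countable_rat]) simp
        ultimately show "r -` (- \<rat>) \<in> sets borel"
          using measurable_sets[of r borel borel "- \<rat>"] by simp
      qed
      then show ?thesis
        using sigma_projective_vimage_image[OF 2(1) 1(3)] 2(2) by simp
    qed
  next
    case suc: 2
    obtain f and C :: "real set" and \<beta> where A: "A = f ` C" "continuous_on C f" "\<beta> \<in> underS omega1 \<alpha>" "- C \<in> Sigma1 \<beta>"
      using 1(2) unfolding Sigma1_rec[of \<alpha>] Sigma1_step_def if_not_P[OF suc(1)] if_P[OF suc(2)]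
      by (elim CollectE exE conjE bexE) (rule that)
    have "sigma_projective (r -` C)" if "continuous_on UNIV r" for r :: "(nat \<Rightarrow> nat) \<Rightarrow> real"
      using sigma_projective_Compl[OF IH[OF A(3,4) that]] by (simp add: vimage_Compl)
    then show ?thesis
      unfolding A(1) by (rule sigma_projective_vimage_image[OF A(2) 1(3)])
  next
    case lim: 3
    obtain F where F: "A = (\<Union>n::nat. F n)" "\<forall>n. \<exists>\<beta>\<in>underS omega1 \<alpha>. F n \<in> Sigma1 \<beta>"
      using 1(2) unfolding Sigma1_rec[of \<alpha>] Sigma1_step_def if_not_P[OF lim(1)] if_not_P[OF lim(2)]
      by (elim CollectE exE conjE) (rule that)
    have "sigma_projective (\<Union>n. h -` F n)"
    proof (rule sigma_projective_UN_nat)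
      fix n
      obtain \<beta> where "\<beta> \<in> underS omega1 \<alpha>" "F n \<in> Sigma1 \<beta>" using F(2) by blast
      then show "sigma_projective (h -` F n)" using 1(3) by (rule IH)
    qed
    then show ?thesis unfolding F(1) by (simp add: vimage_UN)
  qed
qed

section \<open>The Wadge game\<close>

text \<open>The predicate \<open>p\<close> marks the rounds in which the strategy \<open>s\<close>
  moves; in all others the move is read from \<open>x\<close> at the same index. One recursion thus
  serves both players.\<close>

fun play_list :: "(nat \<Rightarrow> bool) \<Rightarrow> (nat list \<Rightarrow> nat) \<Rightarrow> (nat \<Rightarrow> nat) \<Rightarrow> nat \<Rightarrow> nat list" where
  "play_list p s x 0 = []"
| "play_list p s x (Suc n) =
     play_list p s x n @ [if p n then s (play_list p s x n) else x n]"

definition play :: "(nat \<Rightarrow> bool) \<Rightarrow> (nat list \<Rightarrow> nat) \<Rightarrow> (nat \<Rightarrow> nat) \<Rightarrow> nat \<Rightarrow> nat" where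
  "play p s x n = (if p n then s (play_list p s x n) else x n)"

lemma map_play: "map (play p s x) [0..<n] = play_list p s x n"
  by (induction n) (simp_all add: play_def)

lemma play_strategy: "p n \<Longrightarrow> play p s x n = s (map (play p s x) [0..<n])"
  by (simp add: map_play) (simp add: play_def)

lemma play_opponent: "\<not> p n \<Longrightarrow> play p s x n = x n"
  by (simp add: play_def)

lemma continuous_on_finitely_determined:
  fixes F :: "(nat \<Rightarrow> nat) \<Rightarrow> nat \<Rightarrow> nat"
  assumes "\<And>n x x'. (\<And>i. i \<le> n \<Longrightarrow> x i = x' i) \<Longrightarrow> F x n = F x' n"
  shows "continuous_on UNIV F"
proof (rule continuous_on_coordinatewise_then_product)
  fix n
  have "open ((\<lambda>x. F x n) -` B)" for B
  proof (subst open_subopen, intro ballI)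
    fix x assume x: "x \<in> (\<lambda>x. F x n) -` B"
    define N where "N = {x'. \<forall>i\<in>{..n}. x' i \<in> {x i}}"
    have "open N"
      unfolding N_def using product_topology_basis'[of "{..n}" "\<lambda>i. {x i}" "\<lambda>i. i"]
      by (simp add: open_discrete)
    moreover have "x \<in> N" unfolding N_def by simp
    moreover have "N \<subseteq> (\<lambda>x. F x n) -` B"
    proof
      fix x' assume "x' \<in> N"
      then have "F x' n = F x n" unfolding N_def by (intro assms) simp
      then show "x' \<in> (\<lambda>x. F x n) -` B" using x by simp
    qed
    ultimately show "\<exists>T. open T \<and> x \<in> T \<and> T \<subseteq> (\<lambda>x. F x n) -` B" by blast
  qed
  then show "continuous_on UNIV (\<lambda>x. F x n)" by (simp add: continuous_on_open_vimage)
qed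

lemma continuous_on_play: "continuous_on UNIV (play p s)"
proof (rule continuous_on_finitely_determined)
  fix n and x x' :: "nat \<Rightarrow> nat"
  assume eq: "\<And>i. i \<le> n \<Longrightarrow> x i = x' i"
  have "play_list p s x k = play_list p s x' k" if "k \<le> n" for k
    using that by (induction k) (simp_all add: eq)
  then show "play p s x n = play p s x' n" by (simp add: play_def eq)
qed

lemma compact_bounded_sequences: "compact {y :: nat \<Rightarrow> nat. \<forall>i. y i \<le> m}"
proof -
  have "compactin (product_topology (\<lambda>_. euclidean) UNIV) (PiE (UNIV :: nat set) (\<lambda>_. {..m}))"
    unfolding compactin_PiE by (simp add: finite_imp_compact)
  moreover have "PiE (UNIV :: nat set) (\<lambda>_. {..m}) = {y :: nat \<Rightarrow> nat. \<forall>i. y i \<le> m}" by auto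
  ultimately show ?thesis by (simp add: euclidean_product_topology)
qed

text \<open>The 0-1 sequences with infinitely many ones form a copy of the irrationals, which is not
  Menger. The covers witnessing this are complements of compact sets of sequences, and images of
  these compact sets under \<open>g\<close> transport the failure to \<open>B\<close>.\<close>

lemma menger_set_no_complete_reduction:
  fixes g :: "(nat \<Rightarrow> nat) \<Rightarrow> 'a::t2_space"
  assumes menger: "menger_space (top_of_set B)" and g: "continuous_on UNIV g"
    and red: "\<And>x. g x \<in> B \<longleftrightarrow> infinite {n. x n \<noteq> 0}"
  shows False
proof -
  define D where "D = {x :: nat \<Rightarrow> nat. \<forall>i. x i \<le> 1}"
  have D: "compact D" unfolding D_def by (rule compact_bounded_sequences)
  define R where "R n k = {x :: nat \<Rightarrow> nat. (\<Sum>i<k. real (x i)) \<le> real n}" for n k :: nat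
  have R_closed: "closed (R n k)" for n k
    unfolding R_def
    by (intro closed_Collect_le continuous_on_sum continuous_on_coordinate_fun continuous_on_const)
  have R_mono: "R n k' \<subseteq> R n k" if "k \<le> k'" for n k k'
  proof
    fix x assume "x \<in> R n k'"
    moreover have "(\<Sum>i<k. real (x i)) \<le> (\<Sum>i<k'. real (x i))"
      using that by (intro sum_mono2) auto
    ultimately show "x \<in> R n k" unfolding R_def by simp
  qed
  define K where "K n k = g ` (D \<inter> R n k)" for n k
  have K_closed: "closed (K n k)" for n k
    unfolding K_def
    by (intro compact_imp_closed compact_continuous_image compact_Int_closed D R_closed
        continuous_on_subset[OF g]) simp
  have K_mono: "K n k' \<subseteq> K n k" if "k \<le> k'" for n k k'
    unfolding K_def using R_mono[OF that] by blast
  have K_escape: "\<exists>k. b \<notin> K n k" if b: "b \<in> B" for b n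
  proof (rule ccontr)
    assume "\<not> ?thesis"
    then have all: "b \<in> K n k" for k by blast
    \<comment> \<open>Compactness turns the separate witnesses for each \<open>k\<close> into one
      preimage of \<open>b\<close> with at most \<open>n\<close> ones altogether, although a point
      mapped into \<open>B\<close> has infinitely many.\<close>
    have "D \<inter> (\<Inter>k\<in>UNIV. R n k \<inter> g -` {b}) \<noteq> {}"
    proof (rule compact_imp_fip_image[OF D])
      show "closed (R n k \<inter> g -` {b})" for k
        using g by (intro closed_Int R_closed closed_vimage) simp_all
      fix I :: "nat set" assume "finite I"
      then obtain k where k: "\<And>i. i \<in> I \<Longrightarrow> i \<le> k" unfolding finite_nat_set_iff_bounded_le by blast
      obtain x where "x \<in> D" "x \<in> R n k" "g x = b" using all[of k] unfolding K_def by blast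
      then have "x \<in> D \<inter> (\<Inter>i\<in>I. R n i \<inter> g -` {b})" using k R_mono by blast
      then show "D \<inter> (\<Inter>i\<in>I. R n i \<inter> g -` {b}) \<noteq> {}" by blast
    qed
    then obtain x where x: "\<And>k. x \<in> R n k" "g x = b" by blast
    then have "infinite {i. x i \<noteq> 0}" using red b by blast
    then obtain F where F: "F \<subseteq> {i. x i \<noteq> 0}" "finite F" "card F = Suc n"
      using infinite_arbitrarily_large by blast
    obtain k where k: "F \<subseteq> {..<k}" using F(2) finite_nat_iff_bounded by blast
    have "real (card F) = (\<Sum>i\<in>F. 1)" by simp
    also have "\<dots> \<le> (\<Sum>i\<in>F. real (x i))"
      using F(1) by (intro sum_mono) (simp add: subset_iff Suc_le_eq)
    also have "\<dots> \<le> (\<Sum>i<k. real (x i))" using k by (intro sum_mono2) auto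
    also have "\<dots> \<le> real n" using x(1)[of k] unfolding R_def by simp
    finally show False using F(3) by simp
  qed
  define U where "U n k = B - K n k" for n k
  obtain V where V: "\<forall>n. finite (V n)" "\<forall>n. V n \<subseteq> range (U n)"
      "(\<Union>n. \<Union>(V n)) = topspace (top_of_set B)"
  proof (rule menger_space_obtain[OF menger, where U = "\<lambda>n. range (U n)"])
    fix n u assume "u \<in> range (U n)"
    then show "openin (top_of_set B) u"
      unfolding U_def using K_closed by (auto simp: Diff_eq intro!: openin_open_Int)
  next
    show "\<Union>(range (U n)) = topspace (top_of_set B)" for n
      unfolding U_def using K_escape by auto
  qed
  have "\<exists>k. \<Union>(V n) \<subseteq> U n k" for n
  proof -
    obtain I where I: "finite I" "V n = U n ` I"
      using finite_subset_image[OF V(1)[rule_format] V(2)[rule_format]] by metis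
    obtain k where k: "\<And>i. i \<in> I \<Longrightarrow> i \<le> k"
      using I(1) unfolding finite_nat_set_iff_bounded_le by auto
    have "U n i \<subseteq> U n k" if "i \<in> I" for i
      unfolding U_def using K_mono[OF k[OF that]] by blast
    then have "\<Union>(V n) \<subseteq> U n k" unfolding I(2) by (rule UN_least)
    then show ?thesis ..
  qed
  then obtain \<phi> where \<phi>: "\<And>n. \<Union>(V n) \<subseteq> U n (\<phi> n)"
    using choice[of "\<lambda>n k. \<Union>(V n) \<subseteq> U n k"] by auto
  \<comment> \<open>The positions of the ones: the sum ensures \<open>\<phi> n \<le> a n\<close>,
    and the summand \<open>n\<close> makes \<open>a\<close> strictly increasing. Hence only
    \<open>a 0\<close> up to \<open>a (n - 1)\<close> can lie below \<open>\<phi> n\<close>.\<close>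
  define a where "a n = n + (\<Sum>i\<le>n. \<phi> i)" for n
  have a: "strict_mono a" unfolding a_def by (simp add: strict_mono_Suc_iff)
  have a_ge: "\<phi> n \<le> a n" for n
  proof -
    have "\<phi> n \<le> (\<Sum>i\<le>n. \<phi> i)" by (rule member_le_sum) auto
    then show ?thesis unfolding a_def by simp
  qed
  define x where "x i = (if i \<in> range a then 1 else 0 :: nat)" for i
  have "{n. x n \<noteq> 0} = range a" unfolding x_def by auto
  then have "g x \<in> B"
    using red range_inj_infinite[OF strict_mono_imp_inj_on[OF a]] by simp
  have "x \<in> R n (\<phi> n)" for n
  proof -
    have "(\<Sum>i<\<phi> n. real (x i)) = (\<Sum>i | i \<in> {..<\<phi> n} \<and> i \<in> range a. 1)"
      unfolding x_def by (subst sum.inter_filter) (auto intro!: sum.cong)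
    also have "\<dots> = real (card {i \<in> {..<\<phi> n}. i \<in> range a})" by simp
    also have "{i \<in> {..<\<phi> n}. i \<in> range a} \<subseteq> a ` {..<n}"
    proof
      fix i assume "i \<in> {i \<in> {..<\<phi> n}. i \<in> range a}"
      then obtain j where j: "i = a j" "a j < \<phi> n" by auto
      then have "a j < a n" using a_ge[of n] by simp
      then show "i \<in> a ` {..<n}" using j(1) strict_mono_less[OF a] by simp
    qed
    then have "card {i \<in> {..<\<phi> n}. i \<in> range a} \<le> card (a ` {..<n})" by (intro card_mono) auto
    also have "\<dots> \<le> n" using card_image_le[of "{..<n}" a] by simp
    finally show ?thesis unfolding R_def by simp
  qed
  moreover have "x \<in> D" unfolding D_def x_def by simp
  ultimately have gK: "g x \<in> K n (\<phi> n)" for n unfolding K_def by blast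
  have "g x \<in> (\<Union>n. \<Union>(V n))" using V(3) \<open>g x \<in> B\<close> by simp
  then obtain n where "g x \<in> \<Union>(V n)" by (rule UN_E)
  then have "g x \<in> U n (\<phi> n)" by (rule subsetD[OF \<phi>])
  then show False using gK[of n] unfolding U_def by simp
qed

section \<open>Reduction to the eventually zero sequences, and part (b)\<close>

lemma finite_support_iff:
  fixes x :: "nat \<Rightarrow> nat"
  shows "finite {n. x n \<noteq> 0} \<longleftrightarrow> (\<exists>N. \<forall>n\<ge>N. x n = 0)"
  using MOST_nat_le[of "\<lambda>n. x n = 0"] unfolding eventually_cofinite .

lemma closed_zero_from:
  fixes h :: "'a::topological_space \<Rightarrow> nat \<Rightarrow> nat"
  assumes "continuous_on UNIV h"
  shows "closed {y. \<forall>n\<ge>N. h y n = 0}"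
proof (rule closed_Collect_all)
  fix n
  have "closed ((\<lambda>y. h y n) -` {0})"
    using continuous_on_product_then_coordinatewise[OF assms] by (intro closed_vimage) simp_all
  then show "closed {y. N \<le> n \<longrightarrow> h y n = 0}" by (cases "N \<le> n") (simp_all add: vimage_def)
qed

text \<open>The eventually zero sequences are a countable union of closed sets, and so are the codes
  of points of \<open>B\<close>, by pulling back along \<open>h\<close>. Intersecting with the
  compact sets of bounded codes and applying \<open>baire_real\<close> gives the required compact
  subsets of \<open>B\<close>.\<close>

lemma sigma_compact_space_reducible_to_rationals:
  fixes h :: "(nat \<Rightarrow> nat) \<Rightarrow> nat \<Rightarrow> nat"
  assumes h: "continuous_on UNIV h"
    and red: "\<And>y. baire_real y \<in> B \<longleftrightarrow> finite {n. h y n \<noteq> 0}"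
  shows "sigma_compact_space (top_of_set B)"
proof -
  define C where "C m N = {y :: nat \<Rightarrow> nat. \<forall>i. y i \<le> m} \<inter> {y. \<forall>n\<ge>N. h y n = 0}" for m N
  have C: "compact (C m N)" for m N
    unfolding C_def
    by (intro compact_Int_closed compact_bounded_sequences closed_zero_from h)
  define K where "K m N = baire_real ` C m N" for m N
  have "K m N \<subseteq> B" for m N
  proof
    fix b assume "b \<in> K m N"
    then obtain y where y: "y \<in> C m N" "b = baire_real y" unfolding K_def by blast
    then show "b \<in> B" unfolding y(2) red finite_support_iff C_def by blast
  qed
  moreover have "compact (K m N)" for m N
    unfolding K_def
    by (rule compact_continuous_image[OF continuous_on_subset[OF continuous_on_baire_real] C]) simp
  ultimately have "sigma_bounded_in (top_of_set B) (K m N)" for m N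
    unfolding sigma_bounded_in_def by (intro exI[of _ "\<lambda>_. K m N"]) (simp add: compactin_subtopology)
  then have "sigma_bounded_in (top_of_set B) (\<Union>(m, N)\<in>UNIV. K m N)"
    by (intro sigma_bounded_in_countable_Union) auto
  then have "sigma_bounded_in (top_of_set B) B"
  proof (rule sigma_bounded_in_subset)
    show "B \<subseteq> (\<Union>(m, N)\<in>UNIV. K m N)"
    proof
      fix b assume b: "b \<in> B"
      obtain y where y: "baire_real y = b" "\<And>i. y (Suc i) \<le> 1" using baire_real_surj by metis
      then have "finite {n. h y n \<noteq> 0}" using red b by blast
      then obtain N where "\<forall>n\<ge>N. h y n = 0" unfolding finite_support_iff ..
      \<comment> \<open>Only the first coordinate of the chosen code can exceed 1.\<close>
      moreover have "y i \<le> max 1 (y 0)" for i using y(2) by (cases i) (auto simp: le_max_iff_disj)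
      ultimately have "y \<in> C (max 1 (y 0)) N" unfolding C_def by simp
      then have "b \<in> K (max 1 (y 0)) N" unfolding K_def using y(1) by blast
      then show "b \<in> (\<Union>(m, N)\<in>UNIV. K m N)" by blast
    qed
  qed
  then show ?thesis by (simp add: sigma_compact_space_iff_sigma_bounded_in)
qed

lemma sigma_projective_menger_imp_sigma_compact:
  fixes B :: "real set"
  assumes "sigma_projective_determinacy" "sigma_projective B" "menger_space (top_of_set B)"
  shows "sigma_compact_space (top_of_set B)"
proof -
  define ev :: "(nat \<Rightarrow> nat) \<Rightarrow> nat \<Rightarrow> nat" where "ev z = (\<lambda>n. z (2 * n))" for z
  define od :: "(nat \<Rightarrow> nat) \<Rightarrow> nat \<Rightarrow> nat" where "od z = (\<lambda>n. z (2 * n + 1))" for z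
  \<comment> \<open>Every term is repeated, so the opponent's \<open>n\<close>-th move is
    \<open>x n\<close> whether the opponent plays at even or at odd places.\<close>
  define dbl :: "(nat \<Rightarrow> nat) \<Rightarrow> nat \<Rightarrow> nat" where "dbl x = (\<lambda>n. x (n div 2))" for x
  have cont: "continuous_on S ev" "continuous_on S od" "continuous_on S dbl" for S
    unfolding ev_def od_def dbl_def by (rule continuous_on_reindex)+
  define Q where "Q = {z. finite {n. ev z n \<noteq> 0}}"
  define Y where "Y = (\<lambda>z. baire_real (od z)) -` B"
  \<comment> \<open>Player I produces the sequence \<open>ev z\<close> and player II a code
    \<open>od z\<close> of a real; I wins iff the sequence is eventually zero exactly when the real
    is in \<open>B\<close>. A strategy for I therefore reduces membership in \<open>B\<close> to
    being eventually zero, and one for II reduces not being eventually zero to membership in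
    \<open>B\<close>.\<close>
  define W where "W = (Q \<inter> Y) \<union> (- Q \<inter> - Y)"
  have "Q = (\<Union>N. {z. \<forall>n\<ge>N. ev z n = 0})"
    unfolding Q_def finite_support_iff by blast
  then have Q: "sigma_projective Q"
    by (simp only: sigma_projective_UN_nat sigma_projective_borel borel_closed
        closed_zero_from cont)
  have "continuous_on UNIV (\<lambda>z. baire_real (od z))"
    by (rule continuous_on_compose2[OF continuous_on_baire_real cont(2)]) simp
  then have Y: "sigma_projective Y"
    using assms(2) sigma_projective_vimage_Sigma1 unfolding Y_def sigma_projective_iff[of B] by auto
  have "sigma_projective W"
    unfolding W_def
    by (intro sigma_projective_Un sigma_projective_Int sigma_projective_Compl Q Y)
  then have "determined W"
    using assms(1) unfolding sigma_projective_determinacy_def by blast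
  then consider s where "wins_I W s" | s where "wins_II W s"
    unfolding determined_def by blast
  then show ?thesis
  proof cases
    case 1
    define h where "h y = ev (play even s (dbl y))" for y
    have "continuous_on UNIV (\<lambda>y. play even s (dbl y))"
      by (rule continuous_on_compose2[OF continuous_on_play cont(3)]) simp
    then have "continuous_on UNIV h"
      unfolding h_def by (rule continuous_on_compose2[OF cont(1)]) (rule subset_UNIV)
    moreover have "baire_real y \<in> B \<longleftrightarrow> finite {n. h y n \<noteq> 0}" for y
    proof -
      have "play even s (dbl y) \<in> W"
        using 1 play_strategy[of even _ s "dbl y"] unfolding wins_I_def by blast
      moreover have "od (play even s (dbl y)) = y"
        unfolding od_def dbl_def by (simp add: play_opponent)
      ultimately show ?thesis unfolding W_def Q_def Y_def h_def by auto
    qed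
    ultimately show ?thesis by (rule sigma_compact_space_reducible_to_rationals)
  next
    case 2
    define g where "g x = baire_real (od (play odd s (dbl x)))" for x
    have "continuous_on UNIV (\<lambda>x. play odd s (dbl x))"
      by (rule continuous_on_compose2[OF continuous_on_play cont(3)]) simp
    then have "continuous_on UNIV (\<lambda>x. od (play odd s (dbl x)))"
      by (rule continuous_on_compose2[OF cont(2)]) (rule subset_UNIV)
    then have "continuous_on UNIV g"
      unfolding g_def by (rule continuous_on_compose2[OF continuous_on_baire_real]) simp
    moreover have "g x \<in> B \<longleftrightarrow> infinite {n. x n \<noteq> 0}" for x
    proof -
      have "play odd s (dbl x) \<notin> W"
        using 2 play_strategy[of odd _ s "dbl x"] unfolding wins_II_def by blast
      moreover have "ev (play odd s (dbl x)) = x"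
        unfolding ev_def dbl_def by (simp add: play_opponent)
      ultimately show ?thesis unfolding W_def Q_def Y_def g_def by auto
    qed
    ultimately have False by (rule menger_set_no_complete_reduction[OF assms(3)])
    then show ?thesis ..
  qed
qed

section \<open>Transfer along the perfect map: the Menger property passes to the base,
  sigma-compactness back to \<open>X\<close>\<close>

theorem theorem7p2:
  shows "(\<forall>(X :: 'a topology) (B :: 'b topology).
            completely_regular_space X \<and> completely_regular_space B \<and> menger_space X \<and>
            analytic_space B \<and> perfect_preimage X B \<longrightarrow> sigma_compact_space X) \<and>
         (sigma_projective_determinacy \<longrightarrow>
          (\<forall>(X :: 'a topology) (B :: real set).
            completely_regular_space X \<and> menger_space X \<and>
            sigma_projective B \<and> perfect_preimage X (top_of_set B) \<longrightarrow> sigma_compact_space X))"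
proof (intro conjI impI allI)
  fix X :: "'a topology" and B :: "'b topology"
  assume *: "completely_regular_space X \<and> completely_regular_space B \<and> menger_space X \<and>
    analytic_space B \<and> perfect_preimage X B"
  then obtain p where p: "perfect_map X B p" unfolding perfect_preimage_def by blast
  have "menger_space B"
    using menger_space_continuous_map_image * p unfolding perfect_map_def by blast
  then have "sigma_compact_space B"
    using * completely_regular_imp_regular_space by (intro analytic_menger_imp_sigma_compact) auto
  then show "sigma_compact_space X" using p sigma_compact_space_perfect_preimage by blast
next
  fix X :: "'a topology" and B :: "real set"
  assume det: sigma_projective_determinacy
  assume *: "completely_regular_space X \<and> menger_space X \<and> sigma_projective B \<and>
    perfect_preimage X (top_of_set B)"
  then obtain p where p: "perfect_map X (top_of_set B) p" unfolding perfect_preimage_def by blast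
  have "menger_space (top_of_set B)"
    using menger_space_continuous_map_image * p unfolding perfect_map_def by blast
  then have "sigma_compact_space (top_of_set B)"
    using det * by (intro sigma_projective_menger_imp_sigma_compact) auto
  then show "sigma_compact_space X" using p sigma_compact_space_perfect_preimage by blast
qed

end
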